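(* There is a constant $c>0$ such that for every integer $n\ge2$ and every pair of vertices $s,t\in V$, the expected number of forwards performed by the greedy routing algorithm on the OSW graph $G_n$ from source $s$ to target $t$ is at most $c\log^2 n$; i.e., it is $\mathcal{O}(\log^2 n)$. The expectation is over the random long-range edges of $G_n$.
   Context: For an integer $n\ge1$, the $n$-octahedral graph $G'_n=(V,E')$ is the undirected graph with vertex set $V=\{u\in\mathbb{Z}^3:|u_1|+|u_2|+|u_3|=n\}$ and edge set $E'=\{\{v,w\}\subset V: v\neq w,\ |v_i-w_i|\le 1 \text{ for all } i=1,2,3\}$. For $u,v\in V$, $d_{uv}$ denotes the shortest-path distance between $u$ and $v$ in $G'_n$, and $Z_u=\left(\sum_{w\in V\setminus\{u\}} d_{uw}^{-2}\right)^{-1}$. The octahedral small world (OSW) random graph $G_n=(V,E)$ is the directed graph obtained as follows: for every $\{u,v\}\in E'$ both $(u,v)$ and $(v,u)$ belong to $E$; in addition, each vertex $u\in V$, independently of all other vertices, chooses one vertex $v\in V\setminus\{u\}$ with probability $Z_u\,d_{uv}^{-2}$, and the directed (long-range) edge $(u,v)$ is added to $E$. Greedy routing algorithm: a message with target $t$ starts at the source $s$; while the current vertex $u$ is not $t$, $u$ forwards the message to an out-neighbor $v$ of $u$ in $G_n$ maximizing $\frac{v\cdot t}{|v|\,|t|}$ (i.e., minimizing the angle between the vectors $v$ and $t$ in $\mathbb{R}^3$), where $v\cdot t=\sum_{i=1}^3 v_it_i$ and $|w|=(\sum_{i=1}^3 w_i^2)^{1/2}$. Each such step is one forward. *)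

theory Defs
  imports "HOL-Analysis.Analysis" "HOL-Library.Extended_Nonnegative_Real"
begin

type_synonym vtx = "int \<times> int \<times> int"

definition oct_V :: "nat \<Rightarrow> vtx set" where
  "oct_V n = {(a, b, c). \<bar>a\<bar> + \<bar>b\<bar> + \<bar>c\<bar> = int n}"

definition oct_adj :: "nat \<Rightarrow> vtx \<Rightarrow> vtx \<Rightarrow> bool" where
  "oct_adj n v w \<longleftrightarrow> v \<in> oct_V n \<and> w \<in> oct_V n \<and> v \<noteq> w \<and>
     \<bar>fst v - fst w\<bar> \<le> 1 \<and> \<bar>fst (snd v) - fst (snd w)\<bar> \<le> 1 \<and>
     \<bar>snd (snd v) - snd (snd w)\<bar> \<le> 1"

definition oct_E :: "nat \<Rightarrow> (vtx \<times> vtx) set" where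
  "oct_E n = {(v, w). oct_adj n v w}"

definition oct_dist :: "nat \<Rightarrow> vtx \<Rightarrow> vtx \<Rightarrow> nat" where
  "oct_dist n u v = (LEAST k. (u, v) \<in> (oct_E n) ^^ k)"

definition oct_Z :: "nat \<Rightarrow> vtx \<Rightarrow> real" where
  "oct_Z n u = inverse (\<Sum>w\<in>oct_V n - {u}. 1 / (real (oct_dist n u w))^2)"

definition lr_prob :: "nat \<Rightarrow> vtx \<Rightarrow> vtx \<Rightarrow> real" where
  "lr_prob n u v = oct_Z n u / (real (oct_dist n u v))^2"

definition configs :: "nat \<Rightarrow> (vtx \<Rightarrow> vtx) set" where
  "configs n = Pi\<^sub>E (oct_V n) (\<lambda>u. oct_V n - {u})"

text \<open>Probability of a configuration (vertices choose independently).\<close>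
definition config_prob :: "nat \<Rightarrow> (vtx \<Rightarrow> vtx) \<Rightarrow> real" where
  "config_prob n L = (\<Prod>u\<in>oct_V n. lr_prob n u (L u))"

definition out_nbrs :: "nat \<Rightarrow> (vtx \<Rightarrow> vtx) \<Rightarrow> vtx \<Rightarrow> vtx set" where
  "out_nbrs n L u = {w. oct_adj n u w} \<union> {L u}"

definition vec :: "vtx \<Rightarrow> real \<times> real \<times> real" where
  "vec v = (real_of_int (fst v), real_of_int (fst (snd v)), real_of_int (snd (snd v)))"

definition cosang :: "vtx \<Rightarrow> vtx \<Rightarrow> real" where
  "cosang v t = (vec v \<bullet> vec t) / (norm (vec v) * norm (vec t))"

definition greedy_cands :: "nat \<Rightarrow> (vtx \<Rightarrow> vtx) \<Rightarrow> vtx \<Rightarrow> vtx \<Rightarrow> vtx set" where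
  "greedy_cands n L t u =
     {v \<in> out_nbrs n L u. \<forall>w \<in> out_nbrs n L u. cosang w t \<le> cosang v t}"

definition valid_tiebreak :: "(vtx \<Rightarrow> vtx set \<Rightarrow> vtx) \<Rightarrow> bool" where
  "valid_tiebreak tb \<longleftrightarrow> (\<forall>u S. S \<noteq> {} \<longrightarrow> tb u S \<in> S)"

definition greedy_step :: "nat \<Rightarrow> (vtx \<Rightarrow> vtx) \<Rightarrow> (vtx \<Rightarrow> vtx set \<Rightarrow> vtx) \<Rightarrow> vtx \<Rightarrow> vtx \<Rightarrow> vtx" where
  "greedy_step n L tb t u = (if u = t then t else tb u (greedy_cands n L t u))"

definition forwards :: "nat \<Rightarrow> (vtx \<Rightarrow> vtx) \<Rightarrow> (vtx \<Rightarrow> vtx set \<Rightarrow> vtx) \<Rightarrow> vtx \<Rightarrow> vtx \<Rightarrow> ennreal" where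
  "forwards n L tb s t =
     (if \<exists>k. (greedy_step n L tb t ^^ k) s = t
      then ennreal (real (LEAST k. (greedy_step n L tb t ^^ k) s = t)) else \<infinity>)"

definition expected_forwards :: "nat \<Rightarrow> (vtx \<Rightarrow> vtx set \<Rightarrow> vtx) \<Rightarrow> vtx \<Rightarrow> vtx \<Rightarrow> ennreal" where
  "expected_forwards n tb s t =
     (\<Sum>L\<in>configs n. ennreal (config_prob n L) * forwards n L tb s t)"

end

theory Submission
  imports Defs
begin

text \<open>
  Let \<open>q v = 1 - cosang v t\<close>. Some local neighbour of any \<open>u \<noteq> t\<close> has strictly smaller \<open>q\<close>, so greedy
  routing never revisits a vertex, and the number of forwards from \<open>v\<close> does not depend on the
  long-range edges of vertices with larger \<open>q\<close>. Hence the expected number of forwards is bounded by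
  any nonnegative \<open>H\<close> whose expectation drops by at least \<open>1\<close> in every step. As in Kleinberg's
  analysis, the normalising constant \<open>Z\<close> is at least a constant over \<open>ln n\<close>, of order \<open>n\<^sup>2 q u\<close> vertices
  have \<open>q\<close>-value at most \<open>q u / 4\<close>, and they are all at distance \<open>O(n * sqrt (q u))\<close> from \<open>u\<close>; so with
  probability at least a constant over \<open>ln n\<close> one step divides \<open>q\<close> by four. This makes a multiple of
  \<open>ln n * ln (1 + n\<^sup>2 q)\<close> such an \<open>H\<close>.
\<close>

section \<open>Distances in the octahedral graph\<close>

text \<open>Two geometries meet here: forwarding minimises an angle, while long-range edges are
  drawn by graph distance. Up to constants they agree. Graph distance lies between the largest
  coordinate difference and 27 times the sum of the differences, and \<open>n^2 * q\<close> is
  comparable to the squared Euclidean distance from \<open>t\<close>, because central projection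
  between octahedron and sphere is Lipschitz both ways. Such estimates are useless for a single
  local edge, where distortion could outweigh the gain; strict progress therefore needs an exact
  inequality between the norms of neighbouring vertices, and integrality. The logarithm in
  \<open>H\<close> replaces an argument by phases: off the target \<open>n^2 * q\<close> is at least
  1/24, so dividing it by four lowers \<open>ln (1 + n^2 * q)\<close> by a fixed amount, and the
  added 1 keeps \<open>H\<close> nonnegative at \<open>t\<close>, where \<open>q\<close> is
  0.\<close>

lemma oct_V_iff [simp]: "(a, b, c) \<in> oct_V n \<longleftrightarrow> \<bar>a\<bar> + \<bar>b\<bar> + \<bar>c\<bar> = int n"
  by (simp add: oct_V_def)

lemma finite_oct_V: "finite (oct_V n)"
proof (rule finite_subset)
  show "oct_V n \<subseteq> {- int n..int n} \<times> {- int n..int n} \<times> {- int n..int n}"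
    by (auto simp: oct_V_def)
qed auto

definition l1_dist :: "vtx \<Rightarrow> vtx \<Rightarrow> int" where
  "l1_dist u v = \<bar>fst u - fst v\<bar> + \<bar>fst (snd u) - fst (snd v)\<bar> + \<bar>snd (snd u) - snd (snd v)\<bar>"

definition linf_dist :: "vtx \<Rightarrow> vtx \<Rightarrow> int" where
  "linf_dist u v = max \<bar>fst u - fst v\<bar> (max \<bar>fst (snd u) - fst (snd v)\<bar> \<bar>snd (snd u) - snd (snd v)\<bar>)"

text \<open>Zero agrees with both signs, so these are closed octants: a vertex on a coordinate plane
  belongs to the faces on either side.\<close>

definition same_sign :: "int \<Rightarrow> int \<Rightarrow> bool" where
  "same_sign a b \<longleftrightarrow> (0 \<le> a \<and> 0 \<le> b) \<or> (a \<le> 0 \<and> b \<le> 0)"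

lemma relpow_linf_dist: "(u, v) \<in> oct_E n ^^ k \<Longrightarrow> linf_dist u v \<le> int k"
proof (induction k arbitrary: v)
  case 0
  then show ?case by (simp add: linf_dist_def)
next
  case (Suc k)
  then obtain w where "(u, w) \<in> oct_E n ^^ k" "(w, v) \<in> oct_E n"
    by auto
  with Suc.IH[of w] show ?case
    by (auto simp: oct_E_def oct_adj_def linf_dist_def)
qed

text \<open>The absolute values sum to \<open>n\<close> for both vertices, so one coordinate of
  \<open>u\<close> is too large in absolute value and another too small. Shifting one unit between
  them is an edge.\<close>

lemma same_face_step:
  assumes "u \<in> oct_V n" "v \<in> oct_V n" "u \<noteq> v"
    and "same_sign (fst u) (fst v)" "same_sign (fst (snd u)) (fst (snd v))"
      "same_sign (snd (snd u)) (snd (snd v))"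
  obtains w where "oct_adj n u w" "same_sign (fst w) (fst v)"
    "same_sign (fst (snd w)) (fst (snd v))" "same_sign (snd (snd w)) (snd (snd v))"
    "l1_dist w v + 2 = l1_dist u v"
proof -
  obtain a b c a' b' c' where eq: "u = (a, b, c)" "v = (a', b', c')"
    by (metis prod.exhaust)
  have sgn: "x = y" if "\<bar>x\<bar> = \<bar>y\<bar>" "same_sign x y" for x y
    using that by (auto simp: same_sign_def)
  have same: "\<bar>a\<bar> + \<bar>b\<bar> + \<bar>c\<bar> = \<bar>a'\<bar> + \<bar>b'\<bar> + \<bar>c'\<bar>"
    using assms(1,2) by (simp add: eq)
  have neq: "\<not> (\<bar>a\<bar> = \<bar>a'\<bar> \<and> \<bar>b\<bar> = \<bar>b'\<bar> \<and> \<bar>c\<bar> = \<bar>c'\<bar>)"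
    using assms(3-6) sgn[of a a'] sgn[of b b'] sgn[of c c'] by (auto simp: eq)
  have trichotomy: "x > x' \<and> y < y' \<or> x > x' \<and> z < z' \<or> y > y' \<and> x < x' \<or> y > y' \<and> z < z'
      \<or> z > z' \<and> x < x' \<or> z > z' \<and> y < y'"
    if "x + y + z = x' + y' + z'" "\<not> (x = x' \<and> y = y' \<and> z = z')" for x y z x' y' z' :: int
    using that by presburger
  \<comment> \<open>\<open>up\<close> takes its sign from the target because \<open>x\<close> may be
    0; it is used only when the target is larger in absolute value, hence nonzero.\<close>
  define dn where "dn x = x - sgn x" for x :: int
  define up where "up x y = x + sgn y" for x y :: int
  consider "\<bar>a\<bar> > \<bar>a'\<bar>" "\<bar>b\<bar> < \<bar>b'\<bar>" | "\<bar>a\<bar> > \<bar>a'\<bar>" "\<bar>c\<bar> < \<bar>c'\<bar>"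
    | "\<bar>b\<bar> > \<bar>b'\<bar>" "\<bar>a\<bar> < \<bar>a'\<bar>" | "\<bar>b\<bar> > \<bar>b'\<bar>" "\<bar>c\<bar> < \<bar>c'\<bar>"
    | "\<bar>c\<bar> > \<bar>c'\<bar>" "\<bar>a\<bar> < \<bar>a'\<bar>" | "\<bar>c\<bar> > \<bar>c'\<bar>" "\<bar>b\<bar> < \<bar>b'\<bar>"
    using trichotomy[of "\<bar>a\<bar>" "\<bar>b\<bar>" "\<bar>c\<bar>" "\<bar>a'\<bar>" "\<bar>b'\<bar>" "\<bar>c'\<bar>"] same neq by metis
  note cases = this
  have dn: "\<bar>dn x\<bar> = \<bar>x\<bar> - 1 \<and> same_sign (dn x) y \<and> \<bar>dn x - y\<bar> = \<bar>x - y\<bar> - 1 \<and> \<bar>x - dn x\<bar> \<le> 1 \<and> x \<noteq> dn x"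
    if "\<bar>x\<bar> > \<bar>y\<bar>" "same_sign x y" for x y
    using that by (auto simp: dn_def same_sign_def sgn_if)
  have up: "\<bar>up x y\<bar> = \<bar>x\<bar> + 1 \<and> same_sign (up x y) y \<and> \<bar>up x y - y\<bar> = \<bar>x - y\<bar> - 1 \<and> \<bar>x - up x y\<bar> \<le> 1"
    if "\<bar>x\<bar> < \<bar>y\<bar>" "same_sign x y" for x y
    using that by (auto simp: up_def same_sign_def sgn_if)
  have sum: "\<bar>a\<bar> + \<bar>b\<bar> + \<bar>c\<bar> = int n" and ss: "same_sign a a'" "same_sign b b'" "same_sign c c'"
    using assms by (simp_all add: eq)
  from cases show ?thesis
  proof cases
    case 1
    note d = dn[OF 1(1) ss(1)] and p = up[OF 1(2) ss(2)]
    have "\<bar>dn a\<bar> + \<bar>up b b'\<bar> + \<bar>c\<bar> = int n"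
      using d p sum by presburger
    with d p sum have "oct_adj n u (dn a, up b b', c)"
      unfolding eq oct_adj_def oct_V_iff fst_conv snd_conv prod.inject by simp
    moreover have "l1_dist (dn a, up b b', c) v + 2 = l1_dist u v"
      unfolding eq l1_dist_def fst_conv snd_conv using d p by presburger
    ultimately show ?thesis using that d p ss by (simp add: eq)
  next
    case 2
    note d = dn[OF 2(1) ss(1)] and p = up[OF 2(2) ss(3)]
    have "\<bar>dn a\<bar> + \<bar>b\<bar> + \<bar>up c c'\<bar> = int n"
      using d p sum by presburger
    with d p sum have "oct_adj n u (dn a, b, up c c')"
      unfolding eq oct_adj_def oct_V_iff fst_conv snd_conv prod.inject by simp
    moreover have "l1_dist (dn a, b, up c c') v + 2 = l1_dist u v"
      unfolding eq l1_dist_def fst_conv snd_conv using d p by presburger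
    ultimately show ?thesis using that d p ss by (simp add: eq)
  next
    case 3
    note d = dn[OF 3(1) ss(2)] and p = up[OF 3(2) ss(1)]
    have "\<bar>up a a'\<bar> + \<bar>dn b\<bar> + \<bar>c\<bar> = int n"
      using d p sum by presburger
    with d p sum have "oct_adj n u (up a a', dn b, c)"
      unfolding eq oct_adj_def oct_V_iff fst_conv snd_conv prod.inject by simp
    moreover have "l1_dist (up a a', dn b, c) v + 2 = l1_dist u v"
      unfolding eq l1_dist_def fst_conv snd_conv using d p by presburger
    ultimately show ?thesis using that d p ss by (simp add: eq)
  next
    case 4
    note d = dn[OF 4(1) ss(2)] and p = up[OF 4(2) ss(3)]
    have "\<bar>a\<bar> + \<bar>dn b\<bar> + \<bar>up c c'\<bar> = int n"
      using d p sum by presburger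
    with d p sum have "oct_adj n u (a, dn b, up c c')"
      unfolding eq oct_adj_def oct_V_iff fst_conv snd_conv prod.inject by simp
    moreover have "l1_dist (a, dn b, up c c') v + 2 = l1_dist u v"
      unfolding eq l1_dist_def fst_conv snd_conv using d p by presburger
    ultimately show ?thesis using that d p ss by (simp add: eq)
  next
    case 5
    note d = dn[OF 5(1) ss(3)] and p = up[OF 5(2) ss(1)]
    have "\<bar>up a a'\<bar> + \<bar>b\<bar> + \<bar>dn c\<bar> = int n"
      using d p sum by presburger
    with d p sum have "oct_adj n u (up a a', b, dn c)"
      unfolding eq oct_adj_def oct_V_iff fst_conv snd_conv prod.inject by simp
    moreover have "l1_dist (up a a', b, dn c) v + 2 = l1_dist u v"
      unfolding eq l1_dist_def fst_conv snd_conv using d p by presburger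
    ultimately show ?thesis using that d p ss by (simp add: eq)
  next
    case 6
    note d = dn[OF 6(1) ss(3)] and p = up[OF 6(2) ss(2)]
    have "\<bar>a\<bar> + \<bar>up b b'\<bar> + \<bar>dn c\<bar> = int n"
      using d p sum by presburger
    with d p sum have "oct_adj n u (a, up b b', dn c)"
      unfolding eq oct_adj_def oct_V_iff fst_conv snd_conv prod.inject by simp
    moreover have "l1_dist (a, up b b', dn c) v + 2 = l1_dist u v"
      unfolding eq l1_dist_def fst_conv snd_conv using d p by presburger
    ultimately show ?thesis using that d p ss by (simp add: eq)
  qed
qed

lemma same_face_path:
  assumes "u \<in> oct_V n" "v \<in> oct_V n"
    and "same_sign (fst u) (fst v)" "same_sign (fst (snd u)) (fst (snd v))"
      "same_sign (snd (snd u)) (snd (snd v))"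
  shows "\<exists>k. (u, v) \<in> oct_E n ^^ k \<and> 2 * int k \<le> l1_dist u v"
  using assms
proof (induction "nat (l1_dist u v)" arbitrary: u rule: less_induct)
  case less
  show ?case
  proof (cases "u = v")
    case True
    then show ?thesis by (intro exI[of _ 0]) (simp add: l1_dist_def)
  next
    case False
    from same_face_step[OF less.prems(1,2) False less.prems(3-5)]
    obtain w where w: "oct_adj n u w" "same_sign (fst w) (fst v)"
      "same_sign (fst (snd w)) (fst (snd v))" "same_sign (snd (snd w)) (snd (snd v))"
      "l1_dist w v + 2 = l1_dist u v" .
    have "l1_dist w v \<ge> 0" by (simp add: l1_dist_def)
    with w have "nat (l1_dist w v) < nat (l1_dist u v)" by simp
    with less.hyps[of w] w less.prems obtain k where
      "(w, v) \<in> oct_E n ^^ k" "2 * int k \<le> l1_dist w v"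
      by (auto simp: oct_adj_def)
    moreover have "(u, w) \<in> oct_E n" using w by (simp add: oct_E_def)
    ultimately have "(u, v) \<in> oct_E n ^^ Suc k" "2 * int (Suc k) \<le> l1_dist u v"
      using w(5) by (auto intro: relpow_Suc_I2 simp del: relpow.simps)
    then show ?thesis by blast
  qed
qed

text \<open>Each wrong-sign coordinate is emptied onto the next one; the target coordinate keeps its
  sign, or adopts that of \<open>v\<close> if it was zero, so no new sign conflict arises.\<close>

lemma path_between:
  assumes "u \<in> oct_V n" "v \<in> oct_V n"
  shows "\<exists>k. (u, v) \<in> oct_E n ^^ k \<and> int k \<le> 27 * l1_dist u v"
proof -
  obtain a b c a' b' c' where eq: "u = (a, b, c)" "v = (a', b', c')"
    by (metis prod.exhaust)
  define put where "put x w y = (if x > 0 \<or> x = 0 \<and> y \<ge> 0 then x + w else x - w)" for x w y :: int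
  have put: "\<bar>put x w y\<bar> = \<bar>x\<bar> + w \<and> same_sign x (put x w y) \<and> (same_sign x y \<longrightarrow> same_sign (put x w y) y)
      \<and> \<bar>x - put x w y\<bar> = w" if "w \<ge> 0" for x w y
    using that by (auto simp: put_def same_sign_def)
  have ss0: "same_sign 0 x" "same_sign x 0" "same_sign x x" for x by (auto simp: same_sign_def)
  \<comment> \<open>This bounds the cost of a repair: a wrong-signed coordinate is no larger than
    its own contribution to \<open>l1_dist\<close>.\<close>
  have diff: "\<bar>x\<bar> \<le> \<bar>x - y\<bar>" if "\<not> same_sign x y" for x y using that by (auto simp: same_sign_def)
  obtain k1 u1 where 1: "(u, u1) \<in> oct_E n ^^ k1" "u1 \<in> oct_V n" "int k1 \<le> l1_dist u v"
    "same_sign (fst u1) a'" "l1_dist u u1 \<le> 2 * l1_dist u v"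
  proof (cases "same_sign a a'")
    case True
    then show ?thesis using that[of u 0] assms by (auto simp: eq l1_dist_def)
  next
    case False
    define u1 where "u1 = (0::int, put b \<bar>a\<bar> b', c)"
    note p = put[of "\<bar>a\<bar>" b b', simplified]
    have "u1 \<in> oct_V n" using assms p by (auto simp: eq u1_def)
    moreover have "l1_dist u u1 = 2 * \<bar>a\<bar>" using p by (auto simp: eq u1_def l1_dist_def)
    moreover obtain k where "(u, u1) \<in> oct_E n ^^ k" "2 * int k \<le> l1_dist u u1"
      using same_face_path[OF assms(1) \<open>u1 \<in> oct_V n\<close>] p by (auto simp: eq u1_def ss0)
    moreover have "\<bar>a\<bar> \<le> l1_dist u v"
      using diff[OF False] by (auto simp: eq l1_dist_def)
    ultimately show ?thesis
      using that[of u1 k] p  by (auto simp: eq u1_def ss0)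
  qed
  obtain a1 b1 c1 where u1: "u1 = (a1, b1, c1)" by (metis prod.exhaust)
  obtain k2 u2 where 2: "(u1, u2) \<in> oct_E n ^^ k2" "u2 \<in> oct_V n" "int k2 \<le> l1_dist u1 v"
    "same_sign (fst u2) a'" "same_sign (fst (snd u2)) b'" "l1_dist u1 u2 \<le> 2 * l1_dist u1 v"
  proof (cases "same_sign b1 b'")
    case True
    then show ?thesis using that[of u1 0] 1 by (auto simp: eq u1 l1_dist_def)
  next
    case False
    define u2 where "u2 = (a1, 0::int, put c1 \<bar>b1\<bar> c')"
    note p = put[of "\<bar>b1\<bar>" c1 c', simplified]
    have "u2 \<in> oct_V n" using 1 p by (auto simp: u1 u2_def)
    moreover have "l1_dist u1 u2 = 2 * \<bar>b1\<bar>" using p by (auto simp: u1 u2_def l1_dist_def)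
    moreover obtain k where "(u1, u2) \<in> oct_E n ^^ k" "2 * int k \<le> l1_dist u1 u2"
      using same_face_path[OF 1(2) \<open>u2 \<in> oct_V n\<close>] p by (auto simp: eq u1 u2_def ss0)
    moreover have "\<bar>b1\<bar> \<le> l1_dist u1 v"
      using diff[OF False] by (auto simp: eq u1 l1_dist_def)
    ultimately show ?thesis
      using that[of u2 k] p 1(4) by (auto simp: eq u1 u2_def ss0)
  qed
  obtain a2 b2 c2 where u2: "u2 = (a2, b2, c2)" by (metis prod.exhaust)
  obtain k3 u3 where 3: "(u2, u3) \<in> oct_E n ^^ k3" "u3 \<in> oct_V n" "int k3 \<le> l1_dist u2 v"
    "same_sign (fst u3) a'" "same_sign (fst (snd u3)) b'" "same_sign (snd (snd u3)) c'"
    "l1_dist u2 u3 \<le> 2 * l1_dist u2 v"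
  proof (cases "same_sign c2 c'")
    case True
    then show ?thesis using that[of u2 0] 2 by (auto simp: eq u2 l1_dist_def)
  next
    case False
    define u3 where "u3 = (put a2 \<bar>c2\<bar> a', b2, 0::int)"
    note p = put[of "\<bar>c2\<bar>" a2 a', simplified]
    have "u3 \<in> oct_V n" using 2 p by (auto simp: u2 u3_def)
    moreover have "l1_dist u2 u3 = 2 * \<bar>c2\<bar>" using p by (auto simp: u2 u3_def l1_dist_def)
    moreover obtain k where "(u2, u3) \<in> oct_E n ^^ k" "2 * int k \<le> l1_dist u2 u3"
      using same_face_path[OF 2(2) \<open>u3 \<in> oct_V n\<close>] p by (auto simp: eq u2 u3_def ss0)
    moreover have "\<bar>c2\<bar> \<le> l1_dist u2 v"
      using diff[OF False] by (auto simp: eq u2 l1_dist_def)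
    ultimately show ?thesis
      using that[of u3 k] p 2(4-5) by (auto simp: eq u2 u3_def ss0)
  qed
  obtain k4 where 4: "(u3, v) \<in> oct_E n ^^ k4" "2 * int k4 \<le> l1_dist u3 v"
    using same_face_path[OF 3(2) assms(2)] 3 by (auto simp: eq)
  have tri: "l1_dist x v \<le> l1_dist y x + l1_dist y v" for x y
  proof -
    have t: "\<bar>p - r\<bar> \<le> \<bar>q - p\<bar> + \<bar>q - r\<bar>" for p q r :: int by simp
    show ?thesis
      unfolding l1_dist_def
      by (rule order.trans[OF add_mono[OF add_mono[OF t[of _ _ "fst y"] t[of _ _ "fst (snd y)"]]
            t[of _ _ "snd (snd y)"]]]) (simp only: ac_simps order.refl)
  qed
  have "(u, v) \<in> oct_E n ^^ (((k1 + k2) + k3) + k4)"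
    using 1(1) 2(1) 3(1) 4(1) by (meson relpow_trans)
  \<comment> \<open>Each repair at most triples the distance \<open>l\<close> to \<open>v\<close>,
    so the lengths are at most \<open>l\<close>, \<open>3 l\<close>, \<open>9 l\<close> and, on the
    common face, \<open>27 l / 2\<close>.\<close>
  moreover have "int (((k1 + k2) + k3) + k4) \<le> 27 * l1_dist u v"
    using 1(3,5) 2(3,6) 3(3,7) 4(2) tri[of u1 u] tri[of u2 u1] tri[of u3 u2] by linarith
  ultimately show ?thesis by blast
qed

text \<open>Connectedness gives the \<open>LEAST\<close> in \<open>oct_dist\<close> its meaning. The
  upper bound serves to bound edge probabilities from below, the lower bound to control the
  normalising sum.\<close>

lemma
  assumes "u \<in> oct_V n" "v \<in> oct_V n"
  shows oct_dist_le_l1_dist: "int (oct_dist n u v) \<le> 27 * l1_dist u v"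
    and linf_dist_le_oct_dist: "linf_dist u v \<le> int (oct_dist n u v)"
proof -
  obtain k where k: "(u, v) \<in> oct_E n ^^ k" "int k \<le> 27 * l1_dist u v"
    using path_between[OF assms] by blast
  then have "oct_dist n u v \<le> k"
    unfolding oct_dist_def by (intro Least_le)
  with k(2) show "int (oct_dist n u v) \<le> 27 * l1_dist u v" by simp
  have "(u, v) \<in> oct_E n ^^ oct_dist n u v"
    unfolding oct_dist_def using k(1) by (rule LeastI)
  then show "linf_dist u v \<le> int (oct_dist n u v)"
    by (rule relpow_linf_dist)
qed

lemma linf_dist_pos: "u \<noteq> v \<Longrightarrow> linf_dist u v > 0"
  by (auto simp: linf_dist_def prod_eq_iff max_def)

lemma oct_dist_pos:
  "u \<in> oct_V n \<Longrightarrow> v \<in> oct_V n \<Longrightarrow> u \<noteq> v \<Longrightarrow> oct_dist n u v > 0"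
  using linf_dist_le_oct_dist[of u n v] linf_dist_pos[of u v] by simp

section \<open>Independent choices and supersolutions\<close>

lemma oct_V_minus_nonempty:
  assumes "n \<ge> 1" "u \<in> oct_V n"
  shows "oct_V n - {u} \<noteq> {}"
proof -
  obtain a b c where u: "u = (a, b, c)" by (metis prod.exhaust)
  have "(- a, - b, - c) \<in> oct_V n - {u}"
    using assms by (auto simp: u)
  then show ?thesis by blast
qed

lemma inverse_oct_Z_pos:
  assumes "n \<ge> 1" "u \<in> oct_V n"
  shows "(\<Sum>w\<in>oct_V n - {u}. 1 / (real (oct_dist n u w))\<^sup>2) > 0"
proof (rule sum_pos)
  fix w assume "w \<in> oct_V n - {u}"
  then have "oct_dist n u w > 0"
    using assms(2) by (intro oct_dist_pos) auto
  then show "1 / (real (oct_dist n u w))\<^sup>2 > 0" by simp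
qed (use oct_V_minus_nonempty[OF assms] finite_oct_V in auto)

lemma oct_Z_pos: "n \<ge> 1 \<Longrightarrow> u \<in> oct_V n \<Longrightarrow> oct_Z n u > 0"
  unfolding oct_Z_def by (simp add: inverse_oct_Z_pos)

lemma lr_prob_nonneg: "n \<ge> 1 \<Longrightarrow> u \<in> oct_V n \<Longrightarrow> lr_prob n u v \<ge> 0"
  using oct_Z_pos[of n u] by (simp add: lr_prob_def)

lemma sum_lr_prob:
  assumes "n \<ge> 1" "u \<in> oct_V n"
  shows "(\<Sum>v\<in>oct_V n - {u}. lr_prob n u v) = 1"
proof -
  have "(\<Sum>v\<in>oct_V n - {u}. lr_prob n u v)
      = oct_Z n u * (\<Sum>w\<in>oct_V n - {u}. 1 / (real (oct_dist n u w))\<^sup>2)"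
    by (simp add: lr_prob_def sum_distrib_left)
  then show ?thesis
    using inverse_oct_Z_pos[OF assms] by (simp add: oct_Z_def)
qed

lemma config_prob_nonneg: "n \<ge> 1 \<Longrightarrow> config_prob n L \<ge> 0"
  unfolding config_prob_def by (intro prod_nonneg) (auto intro: lr_prob_nonneg)

lemma sum_config_prob:
  assumes "n \<ge> 1"
  shows "(\<Sum>L\<in>configs n. config_prob n L) = 1"
proof -
  have "(\<Sum>L\<in>configs n. config_prob n L)
      = (\<Prod>u\<in>oct_V n. \<Sum>v\<in>oct_V n - {u}. lr_prob n u v)"
    unfolding configs_def config_prob_def
    by (subst prod_sum_PiE) (auto simp: finite_oct_V)
  also have "\<dots> = 1"
    using assms by (intro prod.neutral) (simp add: sum_lr_prob)
  finally show ?thesis .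
qed

text \<open>Fubini for the choice of \<open>u\<close>. Separating the argument \<open>x\<close> from
  \<open>L\<close> lets \<open>indep\<close> say that \<open>G x\<close> ignores
  \<open>L u\<close>.\<close>

lemma expectation_split_choice:
  fixes G :: "vtx \<Rightarrow> (vtx \<Rightarrow> vtx) \<Rightarrow> real"
  assumes n: "n \<ge> 1" and u: "u \<in> oct_V n"
    and indep: "\<And>x L L'. x \<in> oct_V n - {u} \<Longrightarrow> L \<in> configs n \<Longrightarrow> L' \<in> configs n \<Longrightarrow>
      (\<And>w. w \<noteq> u \<Longrightarrow> L w = L' w) \<Longrightarrow> G x L = G x L'"
  shows "(\<Sum>L\<in>configs n. config_prob n L * G (L u) L)
      = (\<Sum>x\<in>oct_V n - {u}. lr_prob n u x * (\<Sum>L\<in>configs n. config_prob n L * G x L))"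
proof -
  define V' where "V' = oct_V n - {u}"
  define R where "R = PiE V' (\<lambda>w. oct_V n - {w})"
  define P' where "P' g = (\<Prod>w\<in>V'. lr_prob n w (g w))" for g
  have V: "oct_V n = insert u V'" "u \<notin> V'" "finite V'"
    using u by (auto simp: V'_def finite_oct_V)
  have configs: "configs n = (\<lambda>(y, g). g(u := y)) ` (V' \<times> R)"
    unfolding configs_def R_def V'_def[symmetric] V(1)
    by (subst PiE_insert_eq) (use V in \<open>auto simp: V'_def\<close>)
  have inj: "inj_on (\<lambda>(y, g). g(u := y)) (V' \<times> R)"
    unfolding R_def using inj_combinator[OF V(2), of "\<lambda>w. oct_V n - {w}"] by (simp add: V'_def)
  have sum_eq: "(\<Sum>L\<in>configs n. f L) = (\<Sum>y\<in>V'. \<Sum>g\<in>R. f (g(u := y)))" for f :: "_ \<Rightarrow> real"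
    unfolding configs by (subst sum.reindex[OF inj]) (simp add: sum.cartesian_product case_prod_unfold)
  have prob_upd: "config_prob n (g(u := y)) = lr_prob n u y * P' g" for g y
  proof -
    have "(\<Prod>w\<in>V'. lr_prob n w ((g(u := y)) w)) = P' g"
      unfolding P'_def using V(2) by (intro prod.cong) auto
    then show ?thesis
      unfolding config_prob_def V(1) using V(2,3) by simp
  qed
  have mem: "g(u := y) \<in> configs n" if "y \<in> V'" "g \<in> R" for y g
    using that unfolding configs by auto
  \<comment> \<open>The choice of \<open>u\<close> is averaged back in at total weight one, so the
    inner expectation is again over all of \<open>configs n\<close> and an induction hypothesis
    applies to it directly.\<close>
  have inner: "(\<Sum>L\<in>configs n. config_prob n L * G x L) = (\<Sum>g\<in>R. P' g * G x (g(u := x)))"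
    if x: "x \<in> V'" for x
  proof -
    have "(\<Sum>L\<in>configs n. config_prob n L * G x L)
        = (\<Sum>y\<in>V'. \<Sum>g\<in>R. lr_prob n u y * (P' g * G x (g(u := x))))"
      unfolding sum_eq prob_upd mult.assoc
    proof (intro sum.cong refl)
      fix y g assume "y \<in> V'" "g \<in> R"
      then have "G x (g(u := y)) = G x (g(u := x))"
        using x by (intro indep mem) (auto simp: V'_def)
      then show "lr_prob n u y * (P' g * G x (g(u := y))) = lr_prob n u y * (P' g * G x (g(u := x)))"
        by simp
    qed
    also have "\<dots> = (\<Sum>y\<in>V'. lr_prob n u y) * (\<Sum>g\<in>R. P' g * G x (g(u := x)))"
      by (simp add: sum_product)
    finally show ?thesis using sum_lr_prob[OF n u] by (simp add: V'_def)
  qed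
  have "(\<Sum>L\<in>configs n. config_prob n L * G (L u) L)
      = (\<Sum>x\<in>V'. lr_prob n u x * (\<Sum>g\<in>R. P' g * G x (g(u := x))))"
    unfolding sum_eq prob_upd by (simp add: sum_distrib_left mult.assoc)
  also have "\<dots> = (\<Sum>x\<in>V'. lr_prob n u x * (\<Sum>L\<in>configs n. config_prob n L * G x L))"
    by (intro sum.cong refl) (simp add: inner)
  finally show ?thesis by (simp add: V'_def)
qed

text \<open>\<open>forwards\<close> without its infinite case, so that expectations are real sums;
  \<open>reaches_target\<close> justifies the replacement.\<close>

definition num_forwards :: "nat \<Rightarrow> (vtx \<Rightarrow> vtx) \<Rightarrow> (vtx \<Rightarrow> vtx set \<Rightarrow> vtx) \<Rightarrow> vtx \<Rightarrow> vtx \<Rightarrow> nat" where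
  "num_forwards n L tb s t = (LEAST k. (greedy_step n L tb t ^^ k) s = t)"

text \<open>\<open>progress\<close> isolates the geometry from the probabilistic argument;
  \<open>exists_closer_neighbour\<close> discharges it.\<close>

locale greedy_routing =
  fixes n :: nat and t :: vtx and tb :: "vtx \<Rightarrow> vtx set \<Rightarrow> vtx"
  assumes n: "n \<ge> 1" and t: "t \<in> oct_V n" and tb: "valid_tiebreak tb"
    and progress: "\<And>u. u \<in> oct_V n \<Longrightarrow> u \<noteq> t \<Longrightarrow>
      \<exists>w. oct_adj n u w \<and> cosang u t < cosang w t"
begin

lemma greedy_step_cong: "L u = L' u \<Longrightarrow> greedy_step n L tb t u = greedy_step n L' tb t u"
  by (simp add: greedy_step_def greedy_cands_def out_nbrs_def)

text \<open>The out-neighbourhood is finite and nonempty, so a maximiser exists; only then does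
  \<open>valid_tiebreak\<close> constrain \<open>tb\<close>.\<close>

lemma
  assumes L: "L u \<in> oct_V n" and u: "u \<in> oct_V n" "u \<noteq> t"
  shows greedy_step_in: "greedy_step n L tb t u \<in> oct_V n"
    and greedy_step_increases: "cosang u t < cosang (greedy_step n L tb t u) t"
    and greedy_step_ge_choice: "cosang (L u) t \<le> cosang (greedy_step n L tb t u) t"
proof -
  let ?N = "out_nbrs n L u"
  have sub: "?N \<subseteq> oct_V n" using L by (auto simp: out_nbrs_def oct_adj_def)
  then have fin: "finite ?N" using finite_oct_V finite_subset by blast
  have ne: "?N \<noteq> {}" by (auto simp: out_nbrs_def)
  have "Max ((\<lambda>w. cosang w t) ` ?N) \<in> (\<lambda>w. cosang w t) ` ?N"
    using fin ne by (intro Max_in) auto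
  then obtain v where v: "v \<in> ?N" "cosang v t = Max ((\<lambda>w. cosang w t) ` ?N)"
    by auto
  then have "v \<in> greedy_cands n L t u"
    using fin by (simp add: greedy_cands_def)
  then have "tb u (greedy_cands n L t u) \<in> greedy_cands n L t u"
    using tb unfolding valid_tiebreak_def by blast
  with u have step: "greedy_step n L tb t u \<in> greedy_cands n L t u"
    by (simp add: greedy_step_def)
  then show "greedy_step n L tb t u \<in> oct_V n"
    using sub by (auto simp: greedy_cands_def)
  show "cosang (L u) t \<le> cosang (greedy_step n L tb t u) t"
    using step by (simp add: greedy_cands_def out_nbrs_def)
  obtain w where "oct_adj n u w" "cosang u t < cosang w t"
    using progress[OF u] by blast
  then have "w \<in> ?N" by (simp add: out_nbrs_def)
  then have "cosang w t \<le> cosang (greedy_step n L tb t u) t"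
    using step unfolding greedy_cands_def by blast
  with \<open>cosang u t < cosang w t\<close> show "cosang u t < cosang (greedy_step n L tb t u) t"
    by simp
qed

lemma configs_in: "L \<in> configs n \<Longrightarrow> u \<in> oct_V n \<Longrightarrow> L u \<in> oct_V n - {u}"
  unfolding configs_def by (rule PiE_mem)

text \<open>Angles are real-valued, so well-foundedness comes from counting the finitely many
  strictly closer vertices.\<close>

lemma closer_induct [consumes 1, case_names closer]:
  assumes "u \<in> oct_V n"
    and "\<And>u. u \<in> oct_V n \<Longrightarrow>
      (\<And>v. v \<in> oct_V n \<Longrightarrow> cosang u t < cosang v t \<Longrightarrow> P v) \<Longrightarrow> P u"
  shows "P u"
  using assms(1)
proof (induction "card {v \<in> oct_V n. cosang u t < cosang v t}" arbitrary: u rule: less_induct)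
  case less
  show ?case
  proof (rule assms(2)[OF less.prems], rule less.hyps)
    fix v assume v: "v \<in> oct_V n" "cosang u t < cosang v t"
    show "card {w \<in> oct_V n. cosang v t < cosang w t} < card {w \<in> oct_V n. cosang u t < cosang w t}"
      using v by (intro psubset_card_mono) (auto simp: finite_oct_V)
  qed
qed

lemma reaches_target:
  assumes L: "L \<in> configs n" and "u \<in> oct_V n"
  shows "\<exists>k. (greedy_step n L tb t ^^ k) u = t"
  using assms(2)
proof (induction u rule: closer_induct)
  case (closer u)
  show ?case
  proof (cases "u = t")
    case True
    then show ?thesis by (intro exI[of _ 0]) simp
  next
    case False
    have Lu: "L u \<in> oct_V n" using configs_in[OF L closer(1)] by simp
    obtain k where "(greedy_step n L tb t ^^ k) (greedy_step n L tb t u) = t"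
      using closer(2) greedy_step_in[of L u, OF Lu closer(1) False]
        greedy_step_increases[of L u, OF Lu closer(1) False] by blast
    then show ?thesis by (intro exI[of _ "Suc k"]) (simp add: funpow_swap1)
  qed
qed

lemma num_forwards_target [simp]: "num_forwards n L tb t t = 0"
  unfolding num_forwards_def by (rule Least_equality) auto

lemma num_forwards_step:
  assumes "L \<in> configs n" "u \<in> oct_V n" "u \<noteq> t"
  shows "num_forwards n L tb u t = Suc (num_forwards n L tb (greedy_step n L tb t u) t)"
proof -
  obtain k where "(greedy_step n L tb t ^^ k) u = t"
    using reaches_target[OF assms(1,2)] by blast
  then have "num_forwards n L tb u t = Suc (LEAST m. (greedy_step n L tb t ^^ Suc m) u = t)"
    unfolding num_forwards_def using assms(3) by (intro Least_Suc) auto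
  then show ?thesis by (simp add: num_forwards_def funpow_swap1)
qed

text \<open>The route from \<open>v\<close> only gets closer to \<open>t\<close>, so it never visits
  \<open>u\<close>, the only vertex where the two configurations may differ.\<close>

lemma num_forwards_independent:
  assumes L: "L \<in> configs n" "L' \<in> configs n" and agree: "\<And>w. w \<noteq> u \<Longrightarrow> L w = L' w"
    and "v \<in> oct_V n" "cosang u t < cosang v t"
  shows "num_forwards n L tb v t = num_forwards n L' tb v t"
  using assms(4,5)
proof (induction v rule: closer_induct)
  case (closer v)
  show ?case
  proof (cases "v = t")
    case False
    have Lv: "L v \<in> oct_V n" using configs_in[OF L(1) closer(1)] by simp
    have eq: "greedy_step n L tb t v = greedy_step n L' tb t v"
      using closer(3) by (intro greedy_step_cong agree) auto
    have "num_forwards n L tb (greedy_step n L tb t v) t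
        = num_forwards n L' tb (greedy_step n L tb t v) t"
      using greedy_step_in[of L v, OF Lv closer(1) False] greedy_step_increases[of L v, OF Lv closer(1) False] closer(3)
      by (intro closer(2)) auto
    then show ?thesis
      using num_forwards_step[OF L(1) closer(1) False] num_forwards_step[OF L(2) closer(1) False]
      by (simp add: eq)
  qed simp
qed

lemma expected_num_forwards_le:
  fixes H :: "vtx \<Rightarrow> real"
  assumes H_target: "H t \<ge> 0"
    and H_step: "\<And>u. u \<in> oct_V n \<Longrightarrow> u \<noteq> t \<Longrightarrow>
      1 + (\<Sum>x\<in>oct_V n - {u}. lr_prob n u x * H (greedy_step n (\<lambda>_. x) tb t u)) \<le> H u"
    and "u \<in> oct_V n"
  shows "(\<Sum>L\<in>configs n. config_prob n L * real (num_forwards n L tb u t)) \<le> H u"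
  using assms(3)
proof (induction u rule: closer_induct)
  case (closer u)
  show ?case
  proof (cases "u = t")
    case True
    then show ?thesis using H_target by simp
  next
    case False
    \<comment> \<open>A step from \<open>u\<close> reads only \<open>L u\<close>, so the constant
      function stands for every \<open>L\<close> with \<open>L u = x\<close>.\<close>
    let ?g = "\<lambda>x. greedy_step n (\<lambda>_. x) tb t u"
    let ?G = "\<lambda>x L. real (num_forwards n L tb (?g x) t)"
    have g: "?g x \<in> oct_V n" "cosang u t < cosang (?g x) t" if "x \<in> oct_V n - {u}" for x
      using greedy_step_in[of "\<lambda>_. x" u] greedy_step_increases[of "\<lambda>_. x" u] that closer(1) False
      by auto
    have "(\<Sum>L\<in>configs n. config_prob n L * real (num_forwards n L tb u t))
        = (\<Sum>L\<in>configs n. config_prob n L + config_prob n L * ?G (L u) L)"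
    proof (intro sum.cong refl)
      fix L assume L: "L \<in> configs n"
      have "greedy_step n L tb t u = ?g (L u)" by (rule greedy_step_cong) simp
      then show "config_prob n L * real (num_forwards n L tb u t) = config_prob n L + config_prob n L * ?G (L u) L"
        using num_forwards_step[OF L closer(1) False] by (simp add: algebra_simps)
    qed
    also have "\<dots> = 1 + (\<Sum>L\<in>configs n. config_prob n L * ?G (L u) L)"
      by (simp add: sum.distrib sum_config_prob[OF n])
    also have "(\<Sum>L\<in>configs n. config_prob n L * ?G (L u) L)
        = (\<Sum>x\<in>oct_V n - {u}. lr_prob n u x * (\<Sum>L\<in>configs n. config_prob n L * ?G x L))"
    proof (rule expectation_split_choice[OF n closer(1), of ?G])
      fix x L L'
      assume "x \<in> oct_V n - {u}" "L \<in> configs n" "L' \<in> configs n" "\<And>w. w \<noteq> u \<Longrightarrow> L w = L' w"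
      then show "?G x L = ?G x L'"
        using num_forwards_independent[of L L' u "?g x"] g[of x] by simp
    qed
    also have "1 + \<dots> \<le> 1 + (\<Sum>x\<in>oct_V n - {u}. lr_prob n u x * H (?g x))"
      using g closer(1,2) lr_prob_nonneg[OF n closer(1)]
      by (intro add_left_mono sum_mono mult_left_mono) auto
    also have "\<dots> \<le> H u" by (rule H_step[OF closer(1) False])
    finally show ?thesis .
  qed
qed

lemma expected_forwards_le:
  fixes H :: "vtx \<Rightarrow> real"
  assumes "H t \<ge> 0"
    and "\<And>u. u \<in> oct_V n \<Longrightarrow> u \<noteq> t \<Longrightarrow>
      1 + (\<Sum>x\<in>oct_V n - {u}. lr_prob n u x * H (greedy_step n (\<lambda>_. x) tb t u)) \<le> H u"
    and s: "s \<in> oct_V n"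
  shows "expected_forwards n tb s t \<le> ennreal (H s)"
proof -
  have "expected_forwards n tb s t
      = (\<Sum>L\<in>configs n. ennreal (config_prob n L * real (num_forwards n L tb s t)))"
    unfolding expected_forwards_def
  proof (intro sum.cong refl)
    fix L assume "L \<in> configs n"
    then have "forwards n L tb s t = ennreal (real (num_forwards n L tb s t))"
      using reaches_target s by (simp add: forwards_def num_forwards_def)
    then show "ennreal (config_prob n L) * forwards n L tb s t
        = ennreal (config_prob n L * real (num_forwards n L tb s t))"
      by (simp add: ennreal_mult' config_prob_nonneg[OF n])
  qed
  also have "\<dots> = ennreal (\<Sum>L\<in>configs n. config_prob n L * real (num_forwards n L tb s t))"
    by (intro sum_ennreal) (simp add: config_prob_nonneg[OF n])
  also have "\<dots> \<le> ennreal (H s)"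
    using expected_num_forwards_le[of H, OF assms] by (rule ennreal_leI)
  finally show ?thesis .
qed

end

section \<open>Progress by local edges\<close>

lemma acute_norm_inequality_aux:
  fixes a x y :: real
  assumes a: "a \<ge> 1" and x: "x < 1" and y: "y < 1" and x': "x > -1" and y': "y > -1"
    and yx: "y \<le> x" and ax: "2 * a * (1 - x) \<ge> 2 - x\<^sup>2"
  shows "2 * a * (1 - x * y) > (x + y) * (2 - x * y)"
proof -
  have xy: "x * y < 1"
  proof -
    have "\<bar>x\<bar> * \<bar>y\<bar> < 1 * 1"
      using x y x' y' by (intro mult_strict_mono') auto
    then show ?thesis by (simp add: abs_mult[symmetric])
  qed
  consider "x \<le> 0" | "x > 0" "y \<le> 0" | "y > 0" by linarith
  then show ?thesis
  proof cases
    case 1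
    then have "(x + y) * (2 - x * y) \<le> 0"
      using yx xy by (intro mult_nonpos_nonneg) auto
    also have "0 < 2 * a * (1 - x * y)" using a xy by simp
    finally show ?thesis .
  next
    case 2
    then have xy0: "x * y \<le> 0" by (simp add: mult_nonneg_nonpos)
    have "(x + y) * (2 - x * y) \<le> x * (2 - x * y)"
      using 2 xy by (intro mult_right_mono) auto
    also have "\<dots> < 1 * (2 - x * y)"
      using x xy by (intro mult_strict_right_mono) auto
    also have "\<dots> \<le> 2 * (1 - x * y)" using xy0 by simp
    also have "\<dots> \<le> 2 * a * (1 - x * y)" using a xy by (intro mult_right_mono) auto
    finally show ?thesis .
  next
    case 3
    \<comment> \<open>After multiplication by \<open>1 - x\<close>, the hypothesis \<open>ax\<close>
      eliminates \<open>a\<close>. What remains is a polynomial inequality, and this identity splits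
      it into terms of known sign for \<open>y \<le> x\<close>.\<close>
    have "(2 - x\<^sup>2) * (1 - x * y) - (1 - x) * (x + y) * (2 - x * y)
        = (1 - x)\<^sup>2 * (2 - x\<^sup>2) + (x - y) * (2 - 3 * x\<^sup>2 + 2 * x ^ 3) + x * (1 - x) * (x - y)\<^sup>2"
      by algebra
    moreover have "2 - 3 * x\<^sup>2 + 2 * x ^ 3 = (1 - x)\<^sup>2 * (1 + 2 * x) + 1"
      by algebra
    moreover have "(1 - x)\<^sup>2 * (1 + 2 * x) + 1 > 0" using 3 yx
      by (intro add_nonneg_pos mult_nonneg_nonneg) auto
    moreover have "x\<^sup>2 < 1" using 3 yx x by (simp add: power_less_one_iff)
    then have "(1 - x)\<^sup>2 * (2 - x\<^sup>2) > 0" using x by (intro mult_pos_pos) auto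
    moreover have "x * (1 - x) * (x - y)\<^sup>2 \<ge> 0" using x 3 yx by simp
    ultimately have "(1 - x) * ((x + y) * (2 - x * y)) < (2 - x\<^sup>2) * (1 - x * y)"
      using yx by (smt (verit) mult.assoc mult_nonneg_nonneg)
    also have "\<dots> \<le> 2 * a * (1 - x) * (1 - x * y)"
      using ax xy by (intro mult_right_mono) auto
    finally have "(1 - x) * ((x + y) * (2 - x * y)) < (1 - x) * (2 * a * (1 - x * y))"
      by (simp add: algebra_simps)
    then show ?thesis using x by (simp add: mult_less_cancel_left_pos)
  qed
qed

text \<open>With \<open>b = a - x\<close> and \<open>c = a - y\<close> the difference of the two sides becomes
  \<open>2 * a * (1 - x * y) - (x + y) * (2 - x * y)\<close>.\<close>

lemma acute_norm_inequality:
  fixes a b c :: real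
  assumes a: "a \<ge> 1" and "b > 0" "c > 0"
    and b: "b\<^sup>2 \<ge> (a - 1)\<^sup>2 + 1" "a\<^sup>2 \<ge> (b - 1)\<^sup>2 + 1"
    and c: "c\<^sup>2 \<ge> (a - 1)\<^sup>2 + 1" "a\<^sup>2 \<ge> (c - 1)\<^sup>2 + 1"
  shows "b * c * (b + c) < (b + c - a) * (a * (b + c) + 2)"
proof -
  define x y where "x = a - b" and "y = a - c"
  have xy: "x < 1" "y < 1"
    unfolding x_def y_def
    using power2_less_imp_less[of "a - 1" b] power2_less_imp_less[of "a - 1" c] assms by auto
  have xy': "x > -1" "y > -1"
    unfolding x_def y_def
    using power2_less_imp_less[of "b - 1" a] power2_less_imp_less[of "c - 1" a] assms by auto
  have ax: "2 * a * (1 - x) \<ge> 2 - x\<^sup>2" "2 * a * (1 - y) \<ge> 2 - y\<^sup>2"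
    using b(1) c(1) by (auto simp: x_def y_def power2_eq_square algebra_simps)
  have "2 * a * (1 - x * y) > (x + y) * (2 - x * y)"
  proof (cases "y \<le> x")
    case True
    then show ?thesis using acute_norm_inequality_aux[of a x y] a xy xy' ax by simp
  next
    case False
    then show ?thesis
      using acute_norm_inequality_aux[of a y x] a xy xy' ax by (simp add: mult.commute add.commute)
  qed
  moreover have "(b + c - a) * (a * (b + c) + 2) - b * c * (b + c)
      = 2 * a * (1 - x * y) - (x + y) * (2 - x * y)"
    unfolding x_def y_def by algebra
  ultimately show ?thesis by linarith
qed

text \<open>If the chords from \<open>u/|u|\<close> to \<open>w1/|w1|\<close> and to \<open>w2/|w2|\<close> form an acute angle, then every
  direction between \<open>w1\<close> and \<open>w2\<close> is closer to one of them than to \<open>u\<close>; subtracting a multiple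
  of \<open>u\<close> only helps.\<close>

lemma closer_direction_in_cone:
  fixes u w1 w2 t :: "'a::real_inner"
  assumes a: "norm u \<ge> 1"
    and w1: "(norm w1)\<^sup>2 \<ge> (norm u - 1)\<^sup>2 + 1" "(norm u)\<^sup>2 \<ge> (norm w1 - 1)\<^sup>2 + 1"
    and w2: "(norm w2)\<^sup>2 \<ge> (norm u - 1)\<^sup>2 + 1" "(norm u)\<^sup>2 \<ge> (norm w2 - 1)\<^sup>2 + 1"
    and d: "(norm (w1 - u))\<^sup>2 = 2" "(norm (w2 - u))\<^sup>2 = 2" "(norm (w1 - w2))\<^sup>2 = 2"
    and t: "t = \<alpha> *\<^sub>R w1 + \<beta> *\<^sub>R w2 - \<gamma> *\<^sub>R u"
    and coeffs: "\<alpha> \<ge> 0" "\<beta> \<ge> 0" "\<gamma> \<ge> 0" "\<alpha> + \<beta> + \<gamma> > 0"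
  shows "t \<bullet> sgn u < t \<bullet> sgn w1 \<or> t \<bullet> sgn u < t \<bullet> sgn w2"
proof -
  define a b c where abc: "a = norm u" "b = norm w1" "c = norm w2"
  define U W1 W2 where UW: "U = sgn u" "W1 = sgn w1" "W2 = sgn w2"
  have "b \<noteq> 0" "c \<noteq> 0"
    using w1(1) w2(1) by (auto simp: abc sum_power2_eq_zero_iff add_nonneg_eq_0_iff)
      (use zero_le_power2[of "norm u - 1"] in linarith)+
  then have pos: "a > 0" "b > 0" "c > 0" using a by (auto simp: abc)
  have dirs: "u = a *\<^sub>R U" "w1 = b *\<^sub>R W1" "w2 = c *\<^sub>R W2"
    using pos by (auto simp: abc UW sgn_div_norm)
  have unit: "norm U = 1" "norm W1 = 1" "norm W2 = 1"
    using pos by (auto simp: UW abc norm_sgn)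
  then have unit': "U \<bullet> U = 1" "W1 \<bullet> W1 = 1" "W2 \<bullet> W2 = 1"
    by (auto simp: norm_eq_1)
  have ineq: "b * c * (b + c) < (b + c - a) * (a * (b + c) + 2)"
    using acute_norm_inequality[of a b c] a pos w1 w2 by (simp add: abc)
  have x1: "2 * a * b * (U \<bullet> W1) = a\<^sup>2 + b\<^sup>2 - 2"
    using d(1) unit' unfolding dirs power2_norm_eq_inner
    by (simp add: inner_diff inner_commute power2_eq_square algebra_simps)
  have x2: "2 * a * c * (U \<bullet> W2) = a\<^sup>2 + c\<^sup>2 - 2"
    using d(2) unit' unfolding dirs power2_norm_eq_inner
    by (simp add: inner_diff inner_commute power2_eq_square algebra_simps)
  have x12: "2 * b * c * (W1 \<bullet> W2) = b\<^sup>2 + c\<^sup>2 - 2"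
    using d(3) unit' unfolding dirs power2_norm_eq_inner
    by (simp add: inner_diff inner_commute power2_eq_square algebra_simps)
  \<comment> \<open>The bracket is \<open>(W1 - U) \<bullet> (W2 - U)\<close>, the inner product of
    the two chords. Clearing denominators turns its positivity into \<open>ineq\<close>.\<close>
  have "2 * a * b * c * (1 + W1 \<bullet> W2 - U \<bullet> W1 - U \<bullet> W2)
      = 2 * a * b * c + a * (2 * b * c * (W1 \<bullet> W2)) - c * (2 * a * b * (U \<bullet> W1))
        - b * (2 * a * c * (U \<bullet> W2))"
    by (simp add: algebra_simps)
  also have "\<dots> = (b + c - a) * (a * (b + c) + 2) - b * c * (b + c)"
    unfolding x1 x2 x12 by algebra
  also have "\<dots> > 0" using ineq by simp
  finally have acute: "1 + W1 \<bullet> W2 - U \<bullet> W1 - U \<bullet> W2 > 0"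
    by (rule zero_less_mult_pos) (use pos in simp)
  have lt: "U \<bullet> W1 < 1" "U \<bullet> W2 < 1"
  proof -
    have "\<bar>a - b\<bar> < 1" "\<bar>a - c\<bar> < 1"
      using power2_less_imp_less[of "a - 1" b] power2_less_imp_less[of "a - 1" c]
        power2_less_imp_less[of "b - 1" a] power2_less_imp_less[of "c - 1" a] w1 w2 pos
      by (auto simp: abc)
    then have "(a - b)\<^sup>2 < 1" "(a - c)\<^sup>2 < 1"
      by (simp_all add: abs_square_less_1)
    then have "2 * a * b * (U \<bullet> W1) < 2 * a * b * 1" "2 * a * c * (U \<bullet> W2) < 2 * a * c * 1"
      unfolding x1 x2 by (simp_all add: power2_eq_square algebra_simps)
    then show "U \<bullet> W1 < 1" "U \<bullet> W2 < 1"
      using pos by (simp_all add: mult_less_cancel_left_pos)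
  qed
  define p q where "p = \<alpha> * b" and "q = \<beta> * c"
  have pq: "p \<ge> 0" "q \<ge> 0" "p + q + \<gamma> * a > 0"
  proof -
    show "p \<ge> 0" "q \<ge> 0" using coeffs pos by (auto simp: p_def q_def)
    show "p + q + \<gamma> * a > 0"
      using coeffs pos unfolding p_def q_def
      by (smt (verit) mult_nonneg_nonneg mult_pos_pos)
  qed
  have t': "t = p *\<^sub>R W1 + q *\<^sub>R W2 - (\<gamma> * a) *\<^sub>R U"
    unfolding t by (subst dirs)+ (simp add: p_def q_def)
  define g where "g = \<gamma> * a"
  have g: "g \<ge> 0" using coeffs pos by (simp add: g_def)
  \<comment> \<open>Splitting off the smaller of \<open>p\<close> and \<open>q\<close> leaves only
    nonnegative terms: \<open>e1\<close> serves \<open>p \<ge> q\<close>, \<open>e2\<close> the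
    other case.\<close>
  have e1: "t \<bullet> W1 - t \<bullet> U = (p - q) * (1 - U \<bullet> W1) + q * (1 + W1 \<bullet> W2 - U \<bullet> W1 - U \<bullet> W2) + g * (1 - U \<bullet> W1)"
    and e2: "t \<bullet> W2 - t \<bullet> U = (q - p) * (1 - U \<bullet> W2) + p * (1 + W1 \<bullet> W2 - U \<bullet> W1 - U \<bullet> W2) + g * (1 - U \<bullet> W2)"
    unfolding t' g_def[symmetric]
    by (simp_all add: inner_diff_left inner_add_left unit' inner_commute[of W1 U]
        inner_commute[of W2 U] inner_commute[of W2 W1] algebra_simps)
  show ?thesis
  proof (cases "p \<ge> q")
    case True
    have "t \<bullet> W1 - t \<bullet> U > 0"
    proof (cases "q > 0")
      case True
      then have "q * (1 + W1 \<bullet> W2 - U \<bullet> W1 - U \<bullet> W2) > 0" using acute by simp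
      then show ?thesis unfolding e1 using \<open>p \<ge> q\<close> lt g
        by (intro add_pos_nonneg add_nonneg_pos) auto
    next
      case False
      then have "q = 0" using pq by simp
      then have "t \<bullet> W1 - t \<bullet> U = (p + g) * (1 - U \<bullet> W1)" unfolding e1 by (simp add: algebra_simps)
      then show ?thesis using pq \<open>q = 0\<close> lt by (simp add: g_def)
    qed
    then show ?thesis by (simp add: UW)
  next
    case False
    then have "p * (1 + W1 \<bullet> W2 - U \<bullet> W1 - U \<bullet> W2) \<ge> 0" "(q - p) * (1 - U \<bullet> W2) > 0"
      using acute pq lt by auto
    then have "t \<bullet> W2 - t \<bullet> U > 0" unfolding e2 using g lt
      by (intro add_pos_nonneg add_nonneg_pos) auto
    then show ?thesis by (simp add: UW)
  qed
qed

text \<open>With \<open>w = u - f + g\<close>, the last two bounds amount to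
  \<open>norm u \<ge> x - y\<close> and \<open>norm w \<ge> y - x + 2\<close>; they follow from
  \<open>norm u \<ge> x\<close> and \<open>norm w \<ge> y + 1\<close>.\<close>

lemma unit_move_norms:
  fixes f g h :: "'a::real_inner"
  assumes orth: "f \<bullet> f = 1" "g \<bullet> g = 1" "h \<bullet> h = 1" "f \<bullet> g = 0" "f \<bullet> h = 0" "g \<bullet> h = 0"
    and x: "x \<ge> 1" "y \<ge> 0"
    and u: "u = x *\<^sub>R f + y *\<^sub>R g + z *\<^sub>R h"
  shows "norm u \<ge> 1" "(norm (u - f + g))\<^sup>2 \<ge> (norm u - 1)\<^sup>2 + 1"
    "(norm u)\<^sup>2 \<ge> (norm (u - f + g) - 1)\<^sup>2 + 1"
proof -
  have orth': "g \<bullet> f = 0" "h \<bullet> f = 0" "h \<bullet> g = 0"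
    using orth by (simp_all add: inner_commute)
  have nu: "(norm u)\<^sup>2 = x\<^sup>2 + y\<^sup>2 + z\<^sup>2"
    unfolding u power2_norm_eq_inner
    by (simp add: inner_add orth orth' power2_eq_square algebra_simps)
  have nw: "(norm (u - f + g))\<^sup>2 = (x - 1)\<^sup>2 + (y + 1)\<^sup>2 + z\<^sup>2"
    unfolding u power2_norm_eq_inner
    by (simp add: inner_add inner_diff orth orth' power2_eq_square algebra_simps)
  have ux: "norm u \<ge> x"
    by (rule power2_le_imp_le) (simp_all add: nu)
  have wy: "norm (u - f + g) \<ge> y + 1"
    by (rule power2_le_imp_le) (simp_all add: nw)
  show "norm u \<ge> 1" using ux x by simp
  have "(norm (u - f + g))\<^sup>2 = (norm u)\<^sup>2 + 2 * (y - x) + 2"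
    unfolding nw nu by (simp add: power2_eq_square algebra_simps)
  then show "(norm (u - f + g))\<^sup>2 \<ge> (norm u - 1)\<^sup>2 + 1"
    "(norm u)\<^sup>2 \<ge> (norm (u - f + g) - 1)\<^sup>2 + 1"
    using ux wy x by (simp_all add: power2_diff)
qed

text \<open>The two pairs of moves needed: both leaving one coordinate, or both entering one.
  Rewriting \<open>t\<close> through the moved vertices gives \<open>u\<close> the coefficient
  \<open>S - (p + q)\<close>, so the last two assumptions in \<open>coeffs\<close> are the sign
  conditions of \<open>closer_direction_in_cone\<close>.\<close>

lemma
  fixes f g h :: "'a::real_inner"
  assumes orth: "f \<bullet> f = 1" "g \<bullet> g = 1" "h \<bullet> h = 1" "f \<bullet> g = 0" "f \<bullet> h = 0" "g \<bullet> h = 0"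
    and u: "u = x *\<^sub>R f + y *\<^sub>R g + z *\<^sub>R h"
    and coeffs: "p \<ge> 0" "q \<ge> 0" "p + q \<ge> S" "2 * (p + q) > S"
  shows closer_unit_move_from: "\<lbrakk>x \<ge> 1; y \<ge> 0; z \<ge> 0; t = p *\<^sub>R (g - f) + q *\<^sub>R (h - f) + S *\<^sub>R u\<rbrakk>
      \<Longrightarrow> t \<bullet> sgn u < t \<bullet> sgn (u - f + g) \<or> t \<bullet> sgn u < t \<bullet> sgn (u - f + h)"
    and closer_unit_move_to: "\<lbrakk>x \<ge> 0; y \<ge> 1; z \<ge> 1; t = p *\<^sub>R (f - g) + q *\<^sub>R (f - h) + S *\<^sub>R u\<rbrakk>
      \<Longrightarrow> t \<bullet> sgn u < t \<bullet> sgn (u - g + f) \<or> t \<bullet> sgn u < t \<bullet> sgn (u - h + f)"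
proof -
  have orth': "g \<bullet> f = 0" "h \<bullet> f = 0" "h \<bullet> g = 0"
    using orth by (simp_all add: inner_commute)
  have dist: "(norm (e - e'))\<^sup>2 = 2" if "e \<bullet> e = 1" "e' \<bullet> e' = 1" "e \<bullet> e' = 0" for e e' :: 'a
    using that by (simp add: power2_norm_eq_inner inner_diff inner_commute)
  {
    assume A: "x \<ge> 1" "y \<ge> 0" "z \<ge> 0" "t = p *\<^sub>R (g - f) + q *\<^sub>R (h - f) + S *\<^sub>R u"
    note n1 = unit_move_norms[OF orth A(1,2) u]
    have u': "u = x *\<^sub>R f + z *\<^sub>R h + y *\<^sub>R g" by (simp add: u)
    note n2 = unit_move_norms[OF orth(1,3,2,5,4) orth'(3) A(1,3) u']
    show "t \<bullet> sgn u < t \<bullet> sgn (u - f + g) \<or> t \<bullet> sgn u < t \<bullet> sgn (u - f + h)"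
    proof (rule closer_direction_in_cone[OF n1 n2(2,3)])
      show "t = p *\<^sub>R (u - f + g) + q *\<^sub>R (u - f + h) - (p + q - S) *\<^sub>R u"
        by (simp add: A algebra_simps)
    qed (use coeffs dist[of g f] dist[of h f] dist[of g h] orth orth' in \<open>auto simp: algebra_simps\<close>)
  next
    assume A: "x \<ge> 0" "y \<ge> 1" "z \<ge> 1" "t = p *\<^sub>R (f - g) + q *\<^sub>R (f - h) + S *\<^sub>R u"
    have u1: "u = y *\<^sub>R g + x *\<^sub>R f + z *\<^sub>R h" by (simp add: u)
    note n1 = unit_move_norms[OF orth(2,1,3) orth'(1) orth(6,5) A(2,1) u1]
    have u2: "u = z *\<^sub>R h + x *\<^sub>R f + y *\<^sub>R g" by (simp add: u)
    note n2 = unit_move_norms[OF orth(3,1,2) orth'(2,3) orth(4) A(3,1) u2]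
    show "t \<bullet> sgn u < t \<bullet> sgn (u - g + f) \<or> t \<bullet> sgn u < t \<bullet> sgn (u - h + f)"
    proof (rule closer_direction_in_cone[OF n1 n2(2,3)])
      show "t = p *\<^sub>R (u - g + f) + q *\<^sub>R (u - h + f) - (p + q - S) *\<^sub>R u"
        by (simp add: A algebra_simps)
    qed (use coeffs dist[of f g] dist[of f h] dist[of h g] orth orth' in \<open>auto simp: algebra_simps\<close>)
  }
qed

section \<open>A closer neighbour on the octahedron\<close>

lemma vec_simps: "vec (a, b, c) = (real_of_int a, real_of_int b, real_of_int c)"
  by (simp add: vec_def)

lemma norm_vec_pos:
  assumes "n \<ge> 1" "v \<in> oct_V n"
  shows "norm (vec v) > 0"
proof -
  obtain a b c where v: "v = (a, b, c)" by (metis prod.exhaust)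
  show ?thesis using assms by (auto simp: v vec_simps zero_prod_def)
qed

lemma cosang_eq_inner_sgn: "cosang v t = sgn (vec v) \<bullet> sgn (vec t)"
  by (simp add: cosang_def sgn_div_norm divide_simps)

text \<open>The coordinates are reflected so that \<open>u\<close> lies in the nonnegative octant and \<open>t\<close> is nonnegative
  wherever \<open>u\<close> vanishes. Then \<open>n t = z + S u\<close>, where \<open>S\<close> is the coordinate sum of \<open>t\<close>, the coordinates
  of \<open>z\<close> add up to zero, and \<open>z\<close> is negative only where \<open>u\<close> is positive; hence \<open>z\<close> is a nonnegative
  combination of two admissible moves. The integrality of \<open>t\<close> enters through \<open>key\<close>: the coefficients of
  the two moves add up to at least \<open>S\<close>, so the coefficient of \<open>u\<close> that remains is nonpositive.\<close>

lemma exists_closer_neighbour: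
  assumes u: "u \<in> oct_V n" and t: "t \<in> oct_V n" and ut: "u \<noteq> t"
  shows "\<exists>w. oct_adj n u w \<and> cosang u t < cosang w t"
proof -
  obtain u1 u2 u3 t1 t2 t3 where eq: "u = (u1, u2, u3)" "t = (t1, t2, t3)"
    by (metis prod.exhaust)
  define s where "s a b = (if a > 0 \<or> a = 0 \<and> b \<ge> 0 then 1 else - 1 :: int)" for a b :: int
  define s1 s2 s3 where "s1 = s u1 t1" and "s2 = s u2 t2" and "s3 = s u3 t3"
  define X1 X2 X3 where "X1 = \<bar>u1\<bar>" and "X2 = \<bar>u2\<bar>" and "X3 = \<bar>u3\<bar>"
  define Y1 Y2 Y3 where "Y1 = s1 * t1" and "Y2 = s2 * t2" and "Y3 = s3 * t3"
  have s: "s a b = 1 \<or> s a b = -1" "a = s a b * \<bar>a\<bar>" "b = s a b * (s a b * b)"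
    "\<bar>s a b * b\<bar> = \<bar>b\<bar>" "\<bar>a\<bar> = 0 \<longrightarrow> s a b * b \<ge> 0" for a b
    by (auto simp: s_def abs_if)
  have sq: "s1 * s1 = 1" "s2 * s2 = 1" "s3 * s3 = 1"
    unfolding s1_def s2_def s3_def by (simp_all add: s_def)
  have abs_s: "\<bar>s1\<bar> = 1" "\<bar>s2\<bar> = 1" "\<bar>s3\<bar> = 1"
    unfolding s1_def s2_def s3_def by (simp_all add: s_def)
  have uX: "u1 = s1 * X1" "u2 = s2 * X2" "u3 = s3 * X3"
    using s(2) unfolding s1_def s2_def s3_def X1_def X2_def X3_def by auto
  have tY: "t1 = s1 * Y1" "t2 = s2 * Y2" "t3 = s3 * Y3"
    using s(3) unfolding s1_def s2_def s3_def Y1_def Y2_def Y3_def by auto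
  have X: "X1 \<ge> 0" "X2 \<ge> 0" "X3 \<ge> 0" "X1 + X2 + X3 = int n"
    using u by (auto simp: X1_def X2_def X3_def eq)
  have Y: "\<bar>Y1\<bar> + \<bar>Y2\<bar> + \<bar>Y3\<bar> = int n"
    using t s(4) by (simp add: Y1_def Y2_def Y3_def s1_def s2_def s3_def eq)
  have XY: "X1 = 0 \<longrightarrow> Y1 \<ge> 0" "X2 = 0 \<longrightarrow> Y2 \<ge> 0" "X3 = 0 \<longrightarrow> Y3 \<ge> 0"
    using s(5) by (auto simp: X1_def X2_def X3_def Y1_def Y2_def Y3_def s1_def s2_def s3_def)
  have neq: "\<not> (X1 = Y1 \<and> X2 = Y2 \<and> X3 = Y3)"
    using ut unfolding eq uX tY by auto
  have n: "n \<ge> 1" using u t ut by (cases n) (auto simp: eq)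

  define S where "S = Y1 + Y2 + Y3"
  define z1 z2 z3 where "z1 = int n * Y1 - S * X1" and "z2 = int n * Y2 - S * X2"
    and "z3 = int n * Y3 - S * X3"
  have zsum: "z1 + z2 + z3 = 0"
  proof -
    have "z1 + z2 + z3 = int n * S - S * (X1 + X2 + X3)"
      by (simp add: z1_def z2_def z3_def S_def algebra_simps)
    then show ?thesis using X(4) by simp
  qed
  have zX: "z1 < 0 \<Longrightarrow> X1 \<ge> 1" "z2 < 0 \<Longrightarrow> X2 \<ge> 1" "z3 < 0 \<Longrightarrow> X3 \<ge> 1"
  proof -
    have "x \<ge> 1" if "int n * y - S * x < 0" "x \<ge> 0" "x = 0 \<longrightarrow> y \<ge> 0" for x y
      using that by (cases "x = 0") (auto simp: mult_less_0_iff)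
    then show "z1 < 0 \<Longrightarrow> X1 \<ge> 1" "z2 < 0 \<Longrightarrow> X2 \<ge> 1" "z3 < 0 \<Longrightarrow> X3 \<ge> 1"
      using X XY unfolding z1_def z2_def z3_def by blast+
  qed
  \<comment> \<open>If some \<open>Yi < 0\<close>, then \<open>Xi \<ge> 1\<close> and the term
    \<open>- S * Xi\<close> suffices. Otherwise \<open>t\<close> shares the octant of
    \<open>u\<close> and \<open>S = n\<close>; being distinct integer points of equal sum, they have
    some \<open>Yi \<le> Xi - 1\<close>.\<close>
  have key: "z1 \<le> - S \<or> z2 \<le> - S \<or> z3 \<le> - S" if S: "S > 0"
  proof -
    have neg: "int n * y - S * x \<le> - S" if "y < 0" "x \<ge> 0" "x = 0 \<longrightarrow> y \<ge> 0" for x y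
    proof -
      have "x \<ge> 1" using that by (cases "x = 0") auto
      then have "S * x \<ge> S" using S by simp
      moreover have "int n * y \<le> 0" using that by (simp add: mult_nonneg_nonpos)
      ultimately show ?thesis by linarith
    qed
    show ?thesis
    proof (cases "Y1 < 0 \<or> Y2 < 0 \<or> Y3 < 0")
      case True
      then show ?thesis using neg X XY unfolding z1_def z2_def z3_def by metis
    next
      case False
      then have Sn: "S = int n" using Y by (auto simp: S_def)
      have "Y1 < X1 \<or> Y2 < X2 \<or> Y3 < X3"
        using X(4) Sn neq unfolding S_def by linarith
      moreover have "int n * y - S * x \<le> - S" if "y < x" for x y
      proof -
        have "int n * (y - x) \<le> int n * (-1)" using that by (intro mult_left_mono) auto
        then show ?thesis by (simp add: Sn algebra_simps)
      qed
      ultimately show ?thesis unfolding z1_def z2_def z3_def by blast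
    qed
  qed
  have nonzero: "\<not> (z1 = 0 \<and> z2 = 0 \<and> z3 = 0)" if "S = 0"
    using that Y n by (auto simp: z1_def z2_def z3_def)

  \<comment> \<open>Reflecting the basis instead of the points keeps all inner products in the
    original space.\<close>
  define f g h :: "real \<times> real \<times> real" where "f = (real_of_int s1, 0, 0)"
    and "g = (0, real_of_int s2, 0)" and "h = (0, 0, real_of_int s3)"
  have rsq: "real_of_int s1 * real_of_int s1 = 1" "real_of_int s2 * real_of_int s2 = 1"
    "real_of_int s3 * real_of_int s3 = 1"
    using sq by (metis of_int_1 of_int_mult)+
  have orth: "f \<bullet> f = 1" "g \<bullet> g = 1" "h \<bullet> h = 1" "f \<bullet> g = 0" "f \<bullet> h = 0" "g \<bullet> h = 0"
    by (simp_all add: f_def g_def h_def rsq)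
  have orth': "g \<bullet> f = 0" "h \<bullet> f = 0" "h \<bullet> g = 0"
    by (simp_all add: f_def g_def h_def)
  have vu: "vec u = real_of_int X1 *\<^sub>R f + real_of_int X2 *\<^sub>R g + real_of_int X3 *\<^sub>R h"
    by (simp add: eq uX vec_simps f_def g_def h_def)
  have vu2: "vec u = real_of_int X2 *\<^sub>R g + real_of_int X1 *\<^sub>R f + real_of_int X3 *\<^sub>R h"
    and vu3: "vec u = real_of_int X3 *\<^sub>R h + real_of_int X1 *\<^sub>R f + real_of_int X2 *\<^sub>R g"
    by (simp_all add: vu)
  have vt: "real n *\<^sub>R vec t = real_of_int z1 *\<^sub>R f + real_of_int z2 *\<^sub>R g + real_of_int z3 *\<^sub>R h
      + real_of_int S *\<^sub>R vec u"
    unfolding vu by (simp add: z1_def z2_def z3_def eq tY vec_simps f_def g_def h_def algebra_simps)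

  define W where "W d1 d2 d3 = (s1 * (X1 + d1), s2 * (X2 + d2), s3 * (X3 + d3))" for d1 d2 d3
  have vW: "vec (W d1 d2 d3) = vec u + real_of_int d1 *\<^sub>R f + real_of_int d2 *\<^sub>R g + real_of_int d3 *\<^sub>R h"
    for d1 d2 d3
    by (simp add: vu W_def vec_simps f_def g_def h_def algebra_simps)
  have adj: "oct_adj n u (W d1 d2 d3)"
    if "\<bar>d1\<bar> \<le> 1" "\<bar>d2\<bar> \<le> 1" "\<bar>d3\<bar> \<le> 1" "d1 + d2 + d3 = 0" "d1 \<noteq> 0 \<or> d2 \<noteq> 0"
      "X1 + d1 \<ge> 0" "X2 + d2 \<ge> 0" "X3 + d3 \<ge> 0" for d1 d2 d3
  proof -
    have "W d1 d2 d3 \<in> oct_V n"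
      using that X(4) by (simp add: W_def abs_mult abs_s)
    moreover have "u1 - s1 * (X1 + d1) = - (s1 * d1)" "u2 - s2 * (X2 + d2) = - (s2 * d2)"
      "u3 - s3 * (X3 + d3) = - (s3 * d3)"
      by (simp_all add: uX algebra_simps)
    moreover have "W d1 d2 d3 \<noteq> u"
      using that abs_s by (auto simp: W_def eq uX)
    ultimately show ?thesis
      using that u by (auto simp: oct_adj_def eq W_def abs_mult abs_s)
  qed
  have closer: "cosang u t < cosang w t"
    if "(real n *\<^sub>R vec t) \<bullet> sgn (vec u) < (real n *\<^sub>R vec t) \<bullet> sgn (vec w)" for w
  proof -
    have "vec t = norm (vec t) *\<^sub>R sgn (vec t)"
      using norm_vec_pos[OF n t] by (simp add: sgn_div_norm)
    then have "real n * norm (vec t) * (sgn (vec t) \<bullet> sgn (vec u))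
        < real n * norm (vec t) * (sgn (vec t) \<bullet> sgn (vec w))"
      using that by (metis inner_scaleR_left mult.assoc)
    then show ?thesis
      using n norm_vec_pos[OF n t]
      by (simp add: cosang_eq_inner_sgn inner_commute mult_less_cancel_left_pos)
  qed
  have conclude: ?thesis
    if "(real n *\<^sub>R vec t) \<bullet> sgn (vec u) < (real n *\<^sub>R vec t) \<bullet> sgn (vec w1)
      \<or> (real n *\<^sub>R vec t) \<bullet> sgn (vec u) < (real n *\<^sub>R vec t) \<bullet> sgn (vec w2)"
      "oct_adj n u w1" "oct_adj n u w2" for w1 w2
    using that closer by blast

  \<comment> \<open>In each case \<open>p + q\<close> is the sum of the positive entries of
    \<open>z\<close>, hence also of the negated negative ones, so it is nonnegative and at least
    every \<open>- zi\<close>. \<open>key\<close> then settles \<open>S > 0\<close>, and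
    \<open>nonzero\<close> gives strictness for \<open>S = 0\<close>.\<close>
  have coeffs: "p + q \<ge> S" "2 * (p + q) > S"
    if "p + q = - z1 \<and> z2 \<ge> 0 \<and> z3 \<ge> 0 \<or> p + q = - z2 \<and> z1 \<ge> 0 \<and> z3 \<ge> 0 \<or> p + q = - z3 \<and> z1 \<ge> 0 \<and> z2 \<ge> 0
      \<or> p + q = z1 \<and> z2 < 0 \<and> z3 < 0 \<or> p + q = z2 \<and> z1 < 0 \<and> z3 < 0 \<or> p + q = z3 \<and> z1 < 0 \<and> z2 < 0"
    for p q
    using that key zsum nonzero by (linarith, smt (verit))
  have rz: "real_of_int z1 + real_of_int z2 + real_of_int z3 = 0"
    using zsum by (metis of_int_0 of_int_add)
  have combine: "real_of_int z1 = - real_of_int z2 - real_of_int z3"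
    "real_of_int z2 = - real_of_int z1 - real_of_int z3"
    "real_of_int z3 = - real_of_int z1 - real_of_int z2"
    using rz by linarith+
  \<comment> \<open>Two negative entries call for moves into the third coordinate, a single one for
    moves out of it. If \<open>z\<close> vanishes, any positive coordinate of \<open>u\<close> can
    be left.\<close>
  consider "z1 < 0 \<and> z2 < 0" | "z1 < 0 \<and> z3 < 0" | "z2 < 0 \<and> z3 < 0"
    | "X1 \<ge> 1 \<and> z2 \<ge> 0 \<and> z3 \<ge> 0" | "X2 \<ge> 1 \<and> z1 \<ge> 0 \<and> z3 \<ge> 0" | "X3 \<ge> 1 \<and> z1 \<ge> 0 \<and> z2 \<ge> 0"
    using zX zsum X n by linarith
  then show ?thesis
  proof cases
    case 1
    then have "X1 \<ge> 1" "X2 \<ge> 1" using zX by auto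
    have "real n *\<^sub>R vec t = real_of_int (- z1) *\<^sub>R (h - f) + real_of_int (- z2) *\<^sub>R (h - g) + real_of_int S *\<^sub>R vec u"
      unfolding vt combine(3) by (simp add: algebra_simps)
    from closer_unit_move_to[OF orth(3,1,2) orth'(2,3) orth(4) vu3 _ _ _ _ _ _ _ this] show ?thesis
      using 1 X coeffs[of "- z1" "- z2"] zsum \<open>X1 \<ge> 1\<close> \<open>X2 \<ge> 1\<close>
      by (intro conclude[of "W (-1) 0 1" "W 0 (-1) 1"] adj) (simp_all add: vW)
  next
    case 2
    then have "X1 \<ge> 1" "X3 \<ge> 1" using zX by auto
    have "real n *\<^sub>R vec t = real_of_int (- z1) *\<^sub>R (g - f) + real_of_int (- z3) *\<^sub>R (g - h) + real_of_int S *\<^sub>R vec u"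
      unfolding vt combine(2) by (simp add: algebra_simps)
    from closer_unit_move_to[OF orth(2,1,3) orth'(1) orth(6,5) vu2 _ _ _ _ _ _ _ this] show ?thesis
      using 2 X coeffs[of "- z1" "- z3"] zsum \<open>X1 \<ge> 1\<close> \<open>X3 \<ge> 1\<close>
      by (intro conclude[of "W (-1) 1 0" "W 0 1 (-1)"] adj) (simp_all add: vW algebra_simps)
  next
    case 3
    then have "X2 \<ge> 1" "X3 \<ge> 1" using zX by auto
    have "real n *\<^sub>R vec t = real_of_int (- z2) *\<^sub>R (f - g) + real_of_int (- z3) *\<^sub>R (f - h) + real_of_int S *\<^sub>R vec u"
      unfolding vt combine(1) by (simp add: algebra_simps)
    from closer_unit_move_to[OF orth vu _ _ _ _ _ _ _ this] show ?thesis
      using 3 X coeffs[of "- z2" "- z3"] zsum \<open>X2 \<ge> 1\<close> \<open>X3 \<ge> 1\<close>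
      by (intro conclude[of "W 1 (-1) 0" "W 1 0 (-1)"] adj) (simp_all add: vW algebra_simps)
  next
    case 4
    have "real n *\<^sub>R vec t = real_of_int z2 *\<^sub>R (g - f) + real_of_int z3 *\<^sub>R (h - f) + real_of_int S *\<^sub>R vec u"
      unfolding vt combine(1) by (simp add: algebra_simps)
    from closer_unit_move_from[OF orth vu _ _ _ _ _ _ _ this] show ?thesis
      using 4 X coeffs[of z2 z3] zsum
      by (intro conclude[of "W (-1) 1 0" "W (-1) 0 1"] adj) (simp_all add: vW algebra_simps)
  next
    case 5
    have "real n *\<^sub>R vec t = real_of_int z1 *\<^sub>R (f - g) + real_of_int z3 *\<^sub>R (h - g) + real_of_int S *\<^sub>R vec u"
      unfolding vt combine(2) by (simp add: algebra_simps)
    from closer_unit_move_from[OF orth(2,1,3) orth'(1) orth(6,5) vu2 _ _ _ _ _ _ _ this] show ?thesis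
      using 5 X coeffs[of z1 z3] zsum
      by (intro conclude[of "W 1 (-1) 0" "W 0 (-1) 1"] adj) (simp_all add: vW algebra_simps)
  next
    case 6
    have "real n *\<^sub>R vec t = real_of_int z1 *\<^sub>R (f - h) + real_of_int z2 *\<^sub>R (g - h) + real_of_int S *\<^sub>R vec u"
      unfolding vt combine(3) by (simp add: algebra_simps)
    from closer_unit_move_from[OF orth(3,1,2) orth'(2,3) orth(4) vu3 _ _ _ _ _ _ _ this] show ?thesis
      using 6 X coeffs[of z1 z2] zsum
      by (intro conclude[of "W 1 0 (-1)" "W 0 1 (-1)"] adj) (simp_all add: vW algebra_simps)
  qed
qed

section \<open>Angles and lattice points\<close>

lemma norm_triple_sq: "(norm (a, b, c))\<^sup>2 = a\<^sup>2 + b\<^sup>2 + c\<^sup>2" for a b c :: real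
  by (simp add: norm_prod_def)

lemma norm_vec_bounds:
  assumes "v \<in> oct_V n"
  shows "norm (vec v) \<le> real n" "(real n)\<^sup>2 \<le> 3 * (norm (vec v))\<^sup>2"
proof -
  obtain a b c where v: "v = (a, b, c)" by (metis prod.exhaust)
  define A B C where "A = \<bar>real_of_int a\<bar>" and "B = \<bar>real_of_int b\<bar>" and "C = \<bar>real_of_int c\<bar>"
  have "\<bar>a\<bar> + \<bar>b\<bar> + \<bar>c\<bar> = int n" using assms by (simp add: v)
  then have sum: "A + B + C = real n"
    unfolding A_def B_def C_def by (metis of_int_abs of_int_add of_int_of_nat_eq)
  have sq: "(norm (vec v))\<^sup>2 = A\<^sup>2 + B\<^sup>2 + C\<^sup>2"
    by (simp add: v vec_simps A_def B_def C_def norm_triple_sq)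
  have nonneg: "A \<ge> 0" "B \<ge> 0" "C \<ge> 0" by (auto simp: A_def B_def C_def)
  have "A\<^sup>2 + B\<^sup>2 + C\<^sup>2 \<le> (A + B + C)\<^sup>2"
    using mult_nonneg_nonneg[OF nonneg(1,2)] mult_nonneg_nonneg[OF nonneg(1,3)]
      mult_nonneg_nonneg[OF nonneg(2,3)]
    by (simp add: power2_eq_square algebra_simps)
  then show "norm (vec v) \<le> real n"
    unfolding sq[symmetric] sum by (rule power2_le_imp_le) simp
  have "3 * (A\<^sup>2 + B\<^sup>2 + C\<^sup>2) - (A + B + C)\<^sup>2 = (A - B)\<^sup>2 + (A - C)\<^sup>2 + (B - C)\<^sup>2"
    by algebra
  then have "(A + B + C)\<^sup>2 \<le> 3 * (A\<^sup>2 + B\<^sup>2 + C\<^sup>2)"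
    using zero_le_power2[of "A - B"] zero_le_power2[of "A - C"] zero_le_power2[of "B - C"] by linarith
  then show "(real n)\<^sup>2 \<le> 3 * (norm (vec v))\<^sup>2"
    unfolding sq sum .
qed

lemma norm_sgn_vec: "n \<ge> 1 \<Longrightarrow> v \<in> oct_V n \<Longrightarrow> norm (sgn (vec v)) = 1"
  using norm_vec_pos[of n v] by (auto simp: norm_sgn)

text \<open>Identifies \<open>1 - cosang\<close> with half a squared distance of unit vectors, which
  makes the triangle inequality available for it.\<close>

lemma chord_eq:
  assumes "n \<ge> 1" "u \<in> oct_V n" "v \<in> oct_V n"
  shows "(norm (sgn (vec u) - sgn (vec v)))\<^sup>2 = 2 * (1 - cosang u v)"
proof -
  have "sgn (vec u) \<bullet> sgn (vec u) = 1" "sgn (vec v) \<bullet> sgn (vec v) = 1"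
    using norm_sgn_vec[OF assms(1)] assms by (simp_all add: norm_eq_1)
  then show ?thesis
    by (simp add: power2_norm_eq_inner inner_diff inner_commute cosang_eq_inner_sgn)
qed

lemma
  assumes "n \<ge> 1" "u \<in> oct_V n" "v \<in> oct_V n"
  shows cosang_le_1: "cosang u v \<le> 1" and cosang_ge_minus_1: "cosang u v \<ge> - 1"
proof -
  have "\<bar>cosang u v\<bar> \<le> norm (sgn (vec u)) * norm (sgn (vec v))"
    unfolding cosang_eq_inner_sgn by (rule Cauchy_Schwarz_ineq2)
  then have "\<bar>cosang u v\<bar> \<le> 1"
    by (simp add: norm_sgn_vec[OF assms(1,2)] norm_sgn_vec[OF assms(1,3)])
  then show "cosang u v \<le> 1" "cosang u v \<ge> - 1" by auto
qed

lemma norm_sgn_diff_le: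
  fixes x y :: "'a::real_normed_vector"
  shows "norm y * norm (sgn x - sgn y) \<le> 2 * norm (x - y)"
proof -
  have "norm y * norm (sgn x - sgn y) = norm (norm y *\<^sub>R (sgn x - sgn y))" by simp
  \<comment> \<open>The difference splits into a radial error and the displacement
    \<open>x - y\<close>, each of norm at most \<open>norm (x - y)\<close>.\<close>
  also have "norm y *\<^sub>R (sgn x - sgn y) = (norm y - norm x) *\<^sub>R sgn x + (x - y)"
    by (cases "x = 0"; cases "y = 0") (simp_all add: sgn_div_norm algebra_simps)
  also have "norm \<dots> \<le> \<bar>norm y - norm x\<bar> * norm (sgn x) + norm (x - y)"
    by (rule norm_triangle_le) simp
  also have "\<dots> \<le> \<bar>norm y - norm x\<bar> * 1 + norm (x - y)"
    by (intro add_right_mono mult_left_mono) (auto simp: norm_sgn)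
  also have "\<dots> \<le> 2 * norm (x - y)"
    using norm_triangle_ineq3[of y x] by (simp add: norm_minus_commute)
  finally show ?thesis .
qed

lemma one_minus_cosang_le:
  assumes "n \<ge> 1" "u \<in> oct_V n" "t \<in> oct_V n"
  shows "(real n)\<^sup>2 * (1 - cosang u t) \<le> 6 * (norm (vec u - vec t))\<^sup>2"
proof -
  have "(norm (vec t) * norm (sgn (vec u) - sgn (vec t)))\<^sup>2 \<le> (2 * norm (vec u - vec t))\<^sup>2"
    by (intro power_mono norm_sgn_diff_le) simp
  then have *: "(norm (vec t))\<^sup>2 * (2 * (1 - cosang u t)) \<le> 4 * (norm (vec u - vec t))\<^sup>2"
    by (simp add: power_mult_distrib chord_eq[OF assms])
  have "(real n)\<^sup>2 * (1 - cosang u t) \<le> (3 * (norm (vec t))\<^sup>2) * (1 - cosang u t)"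
    using norm_vec_bounds(2)[OF assms(3)] cosang_le_1[OF assms] by (intro mult_right_mono) auto
  with * show ?thesis by (simp add: algebra_simps)
qed

text \<open>Central projection from the sphere back to the octahedron is Lipschitz. The constant is
  4 * 3 * 2: squaring the factor 2, comparing \<open>N\<close> with the Euclidean norm, and
  \<open>chord_eq\<close>.\<close>

lemma l1_dist_le_chord:
  assumes "n \<ge> 1" "u \<in> oct_V n" "v \<in> oct_V n"
  shows "(real_of_int (l1_dist u v))\<^sup>2 \<le> 24 * (real n)\<^sup>2 * (1 - cosang u v)"
proof -
  define N :: "real \<times> real \<times> real \<Rightarrow> real" where "N = (\<lambda>x. \<bar>fst x\<bar> + \<bar>fst (snd x)\<bar> + \<bar>snd (snd x)\<bar>)"
  have N_scale: "N (r *\<^sub>R x) = \<bar>r\<bar> * N x" for r x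
    by (simp add: N_def abs_mult algebra_simps)
  have N_add: "N (x + y) \<le> N x + N y" for x y
    using abs_triangle_ineq[of "fst x" "fst y"] abs_triangle_ineq[of "fst (snd x)" "fst (snd y)"]
      abs_triangle_ineq[of "snd (snd x)" "snd (snd y)"]
    unfolding N_def fst_add snd_add by linarith
  have N_nonneg: "N x \<ge> 0" for x by (simp add: N_def)
  have N_sq: "(N x)\<^sup>2 \<le> 3 * (norm x)\<^sup>2" for x
  proof -
    obtain a b c where x: "x = (a, b, c)" by (metis prod.exhaust)
    define A B C where "A = \<bar>a\<bar>" and "B = \<bar>b\<bar>" and "C = \<bar>c\<bar>"
    have "3 * (A\<^sup>2 + B\<^sup>2 + C\<^sup>2) - (A + B + C)\<^sup>2 = (A - B)\<^sup>2 + (A - C)\<^sup>2 + (B - C)\<^sup>2"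
      by algebra
    then have "(A + B + C)\<^sup>2 \<le> 3 * (A\<^sup>2 + B\<^sup>2 + C\<^sup>2)"
      using zero_le_power2[of "A - B"] zero_le_power2[of "A - C"] zero_le_power2[of "B - C"] by linarith
    moreover have "(norm x)\<^sup>2 = A\<^sup>2 + B\<^sup>2 + C\<^sup>2"
      by (simp add: x norm_triple_sq A_def B_def C_def)
    ultimately show ?thesis by (simp add: x N_def A_def B_def C_def)
  qed
  have N_vec: "N (vec w) = real n" if "w \<in> oct_V n" for w
  proof -
    obtain a b c where w: "w = (a, b, c)" by (metis prod.exhaust)
    have "\<bar>a\<bar> + \<bar>b\<bar> + \<bar>c\<bar> = int n" using that by (simp add: w)
    then show ?thesis unfolding N_def w vec_simps fst_conv snd_conv
      by (metis of_int_abs of_int_add of_int_of_nat_eq)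
  qed
  have l1: "real_of_int (l1_dist u v) = N (vec u - vec v)"
    by (simp add: l1_dist_def N_def vec_def)
  define a b U W where "a = norm (vec u)" and "b = norm (vec v)" and "U = sgn (vec u)" and "W = sgn (vec v)"
  have pos: "a > 0" "b > 0"
    using norm_vec_pos assms by (auto simp: a_def b_def)
  have dirs: "vec u = a *\<^sub>R U" "vec v = b *\<^sub>R W"
    using pos by (auto simp: a_def b_def U_def W_def sgn_div_norm)
  have n_eq: "real n = a * N U" "real n = b * N W"
    using N_vec[OF assms(2)] N_vec[OF assms(3)] pos by (auto simp: dirs N_scale)
  have tri: "\<bar>N U - N W\<bar> \<le> N (U - W)"
  proof -
    have "N (W - U) = N (U - W)" by (simp add: N_def abs_minus_commute)
    then show ?thesis using N_add[of "U - W" W] N_add[of "W - U" U] by simp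
  qed
  have "N (vec u - vec v) = N (a *\<^sub>R (U - W) + (a - b) *\<^sub>R W)"
    by (simp add: dirs algebra_simps)
  also have "\<dots> \<le> a * N (U - W) + \<bar>a - b\<bar> * N W"
    using N_add[of "a *\<^sub>R (U - W)" "(a - b) *\<^sub>R W"] pos by (simp add: N_scale)
  also have "\<bar>a - b\<bar> * N W = \<bar>(a - b) * N W\<bar>"
    using N_nonneg[of W] by (simp add: abs_mult)
  \<comment> \<open>Both vertices have 1-norm \<open>n\<close>, so the difference of their Euclidean
    norms is controlled by the directions alone.\<close>
  also have "(a - b) * N W = a * (N W - N U)"
    using n_eq by (simp add: algebra_simps)
  also have "\<bar>a * (N W - N U)\<bar> \<le> a * N (U - W)"
    using tri pos by (simp add: abs_mult abs_minus_commute)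
  finally have "N (vec u - vec v) \<le> 2 * a * N (U - W)" by simp
  also have "\<dots> \<le> 2 * real n * N (U - W)"
    using norm_vec_bounds(1)[OF assms(2)] N_nonneg by (intro mult_right_mono) (auto simp: a_def)
  finally have "(N (vec u - vec v))\<^sup>2 \<le> (2 * real n * N (U - W))\<^sup>2"
    using N_nonneg by (intro power_mono) auto
  also have "\<dots> = 4 * (real n)\<^sup>2 * (N (U - W))\<^sup>2"
    by (simp add: power_mult_distrib)
  also have "\<dots> \<le> 4 * (real n)\<^sup>2 * (3 * (2 * (1 - cosang u v)))"
    using N_sq[of "U - W"] chord_eq[OF assms] by (intro mult_left_mono) (auto simp: U_def W_def)
  finally show ?thesis by (simp add: l1 algebra_simps)
qed

lemma one_minus_cosang_triangle:
  assumes "n \<ge> 1" "u \<in> oct_V n" "v \<in> oct_V n" "t \<in> oct_V n"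
  shows "1 - cosang u v \<le> 2 * (1 - cosang u t) + 2 * (1 - cosang v t)"
proof -
  let ?U = "sgn (vec u)" and ?W = "sgn (vec v)" and ?T = "sgn (vec t)"
  have "norm (?U - ?W) \<le> norm (?U - ?T) + norm (?W - ?T)"
    using norm_triangle_ineq4[of "?U - ?T" "?W - ?T"] by simp
  then have "(norm (?U - ?W))\<^sup>2 \<le> (norm (?U - ?T) + norm (?W - ?T))\<^sup>2"
    by (intro power_mono) auto
  also have "\<dots> \<le> 2 * (norm (?U - ?T))\<^sup>2 + 2 * (norm (?W - ?T))\<^sup>2"
    using sum_squares_bound[of "norm (?U - ?T)" "norm (?W - ?T)"]
    by (simp add: power2_sum)
  finally show ?thesis
    using chord_eq[of n u v] chord_eq[of n u t] chord_eq[of n v t] assms by simp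
qed

text \<open>Some coordinate of \<open>t\<close> is at least \<open>n / 3\<close>, hence
  \<open>2 m\<close>, in absolute value. Moving \<open>i, j \<le> m\<close> units from it outward
  onto the other two gives \<open>(m + 1)^2\<close> distinct vertices, displaced by at most
  \<open>4 m^2 + m^2 + m^2\<close> in square.\<close>

lemma lattice_disc:
  assumes t: "t \<in> oct_V n" and m: "6 * m \<le> n"
  shows "\<exists>A\<subseteq>oct_V n. card A = (m + 1)\<^sup>2 \<and> (\<forall>v\<in>A. (norm (vec v - vec t))\<^sup>2 \<le> 6 * (real m)\<^sup>2)"
proof -
  obtain t1 t2 t3 where eq: "t = (t1, t2, t3)" by (metis prod.exhaust)
  define s where "s a = (if a \<ge> 0 then 1 else - 1 :: int)" for a :: int
  have s: "\<bar>s a * (\<bar>a\<bar> + d)\<bar> = \<bar>\<bar>a\<bar> + d\<bar>" for a d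
    by (auto simp: s_def)
  have s_inj: "s a \<noteq> 0" for a by (auto simp: s_def)
  have s_sq: "(real_of_int (s a) * (\<bar>real_of_int a\<bar> + r) - real_of_int a)\<^sup>2 = r\<^sup>2" for a r
    by (simp add: s_def)
  define P where "P x y z i j = (s x * (\<bar>x\<bar> + (- int i - int j)), s y * (\<bar>y\<bar> + int i), s z * (\<bar>z\<bar> + int j))"
    for x y z i j
  have sum: "\<bar>t1\<bar> + \<bar>t2\<bar> + \<bar>t3\<bar> = int n" using t by (simp add: eq)
  have sq: "(- real i - real j)\<^sup>2 + (real i)\<^sup>2 + (real j)\<^sup>2 \<le> 6 * (real m)\<^sup>2" if "i \<le> m" "j \<le> m" for i j
  proof -
    have "(real i + real j)\<^sup>2 \<le> (2 * real m)\<^sup>2" using that by (intro power_mono) auto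
    moreover have "(real i)\<^sup>2 \<le> (real m)\<^sup>2" "(real j)\<^sup>2 \<le> (real m)\<^sup>2" using that by (auto intro: power_mono)
    moreover have "(- real i - real j)\<^sup>2 = (real i + real j)\<^sup>2" by algebra
    moreover have "(2 * real m)\<^sup>2 = 4 * (real m)\<^sup>2" by algebra
    ultimately show ?thesis by linarith
  qed
  have sq': "(real i)\<^sup>2 + (- real i - real j)\<^sup>2 + (real j)\<^sup>2 \<le> 6 * (real m)\<^sup>2"
    "(real i)\<^sup>2 + (real j)\<^sup>2 + (- real i - real j)\<^sup>2 \<le> 6 * (real m)\<^sup>2" if "i \<le> m" "j \<le> m" for i j
    using sq[OF that] by linarith+
  have card: "card ((\<lambda>(i, j). \<phi> (P x y z i j)) ` ({..m} \<times> {..m})) = (m + 1)\<^sup>2" if "inj \<phi>"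
    for \<phi> :: "int \<times> int \<times> int \<Rightarrow> vtx" and x y z
  proof -
    have "inj_on (\<lambda>(i, j). \<phi> (P x y z i j)) ({..m} \<times> {..m})"
      by (auto simp: inj_on_def P_def s_inj inj_eq[OF that])
    then show ?thesis by (subst card_image) (auto simp: power2_eq_square)
  qed
  consider "\<bar>t1\<bar> \<ge> 2 * int m" | "\<bar>t2\<bar> \<ge> 2 * int m" | "\<bar>t3\<bar> \<ge> 2 * int m"
    using sum m by linarith
  then show ?thesis
  proof cases
    case 1
    let ?f = "\<lambda>(i, j). P t1 t2 t3 i j"
    have "?f ij \<in> oct_V n \<and> (norm (vec (?f ij) - vec t))\<^sup>2 \<le> 6 * (real m)\<^sup>2" if "ij \<in> {..m} \<times> {..m}" for ij
      using that 1 sum sq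
      by (auto simp: P_def s eq vec_simps norm_triple_sq s_sq)
    then show ?thesis using card[of "\<lambda>v. v" t1 t2 t3]
      by (intro exI[of _ "?f ` ({..m} \<times> {..m})"]) auto
  next
    case 2
    let ?\<phi> = "\<lambda>(a, b, c). (b, a, c)" and ?f = "\<lambda>(i, j). (\<lambda>(a, b, c). (b, a, c)) (P t2 t1 t3 i j)"
    have "?f ij \<in> oct_V n \<and> (norm (vec (?f ij) - vec t))\<^sup>2 \<le> 6 * (real m)\<^sup>2" if "ij \<in> {..m} \<times> {..m}" for ij
      using that 2 sum sq'(1)
      by (auto simp: P_def s eq vec_simps norm_triple_sq s_sq)
    moreover have "inj ?\<phi>" by (auto simp: inj_def)
    ultimately show ?thesis using card[of ?\<phi> t2 t1 t3]
      by (intro exI[of _ "?f ` ({..m} \<times> {..m})"]) auto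
  next
    case 3
    let ?\<phi> = "\<lambda>(a, b, c). (b, c, a)" and ?f = "\<lambda>(i, j). (\<lambda>(a, b, c). (b, c, a)) (P t3 t1 t2 i j)"
    have "?f ij \<in> oct_V n \<and> (norm (vec (?f ij) - vec t))\<^sup>2 \<le> 6 * (real m)\<^sup>2" if "ij \<in> {..m} \<times> {..m}" for ij
      using that 3 sum sq'(2)
      by (auto simp: P_def s eq vec_simps norm_triple_sq s_sq)
    moreover have "inj ?\<phi>" by (auto simp: inj_def)
    ultimately show ?thesis using card[of ?\<phi> t3 t1 t2]
      by (intro exI[of _ "?f ` ({..m} \<times> {..m})"]) auto
  qed
qed

section \<open>Probability of a good long-range edge\<close>

text \<open>One of three coordinates differs by exactly \<open>k\<close> (2 signs), another by at
  most \<open>k\<close> (\<open>2 k + 1\<close> values), and the octahedron fixes the last up to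
  sign. The total is \<open>12 * (2 k + 1)\<close>, at most \<open>36 k\<close>.\<close>

lemma sphere_card_le:
  assumes u: "u \<in> oct_V n" and k: "k \<ge> 1"
  shows "card {w \<in> oct_V n. linf_dist u w = int k} \<le> 36 * k"
proof -
  obtain u1 u2 u3 where eq: "u = (u1, u2, u3)" by (metis prod.exhaust)
  define I where "I = {- 1, 1 :: int} \<times> {- int k..int k} \<times> {- 1, 1 :: int}"
  define F1 F2 F3 where
    "F1 = (\<lambda>(e, d, e'). (u1 + e * int k, u2 + d, e' * (int n - \<bar>u1 + e * int k\<bar> - \<bar>u2 + d\<bar>)))"
    and "F2 = (\<lambda>(e, d, e'). (u1 + d, u2 + e * int k, e' * (int n - \<bar>u1 + d\<bar> - \<bar>u2 + e * int k\<bar>)))"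
    and "F3 = (\<lambda>(e, d, e'). (u1 + d, e' * (int n - \<bar>u1 + d\<bar> - \<bar>u3 + e * int k\<bar>), u3 + e * int k))"
  have sub: "{w \<in> oct_V n. linf_dist u w = int k} \<subseteq> F1 ` I \<union> F2 ` I \<union> F3 ` I"
  proof
    fix w assume w: "w \<in> {w \<in> oct_V n. linf_dist u w = int k}"
    obtain a b c where weq: "w = (a, b, c)" by (metis prod.exhaust)
    have sum: "\<bar>a\<bar> + \<bar>b\<bar> + \<bar>c\<bar> = int n" using w by (simp add: weq)
    have max: "max \<bar>u1 - a\<bar> (max \<bar>u2 - b\<bar> \<bar>u3 - c\<bar>) = int k"
      using w by (simp add: weq eq linf_dist_def)
    have pm: "\<exists>e\<in>{- 1, 1}. x = y + e * int k" if "\<bar>y - x\<bar> = int k" for x y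
    proof (cases "x \<ge> y")
      case True
      then show ?thesis using that by (intro bexI[of _ 1]) auto
    next
      case False
      then show ?thesis using that by (intro bexI[of _ "-1"]) auto
    qed
    have sg: "\<exists>e\<in>{- 1, 1}. x = e * \<bar>x\<bar>" for x :: int
      by (cases "x \<ge> 0") auto
    consider "\<bar>u1 - a\<bar> = int k" | "\<bar>u2 - b\<bar> = int k" | "\<bar>u3 - c\<bar> = int k"
      using max unfolding max_def by metis
    then show "w \<in> F1 ` I \<union> F2 ` I \<union> F3 ` I"
    proof cases
      case 1
      obtain e where e: "e \<in> {- 1, 1}" "a = u1 + e * int k" using pm[OF 1] by blast
      obtain e' where e': "e' \<in> {- 1, 1}" "c = e' * \<bar>c\<bar>" using sg by blast
      have "\<bar>c\<bar> = int n - \<bar>a\<bar> - \<bar>b\<bar>" using sum by simp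
      then have "w = F1 (e, b - u2, e')" using e e' by (simp add: F1_def weq)
      moreover have "(e, b - u2, e') \<in> I" using e(1) e'(1) max by (auto simp: I_def)
      ultimately show ?thesis by blast
    next
      case 2
      obtain e where e: "e \<in> {- 1, 1}" "b = u2 + e * int k" using pm[OF 2] by blast
      obtain e' where e': "e' \<in> {- 1, 1}" "c = e' * \<bar>c\<bar>" using sg by blast
      have "\<bar>c\<bar> = int n - \<bar>a\<bar> - \<bar>b\<bar>" using sum by simp
      then have "w = F2 (e, a - u1, e')" using e e' by (simp add: F2_def weq)
      moreover have "(e, a - u1, e') \<in> I" using e(1) e'(1) max by (auto simp: I_def)
      ultimately show ?thesis by blast
    next
      case 3
      obtain e where e: "e \<in> {- 1, 1}" "c = u3 + e * int k" using pm[OF 3] by blast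
      obtain e' where e': "e' \<in> {- 1, 1}" "b = e' * \<bar>b\<bar>" using sg by blast
      have "\<bar>b\<bar> = int n - \<bar>a\<bar> - \<bar>c\<bar>" using sum by simp
      then have "w = F3 (e, a - u1, e')" using e e' by (simp add: F3_def weq)
      moreover have "(e, a - u1, e') \<in> I" using e(1) e'(1) max by (auto simp: I_def)
      ultimately show ?thesis by blast
    qed
  qed
  have fin: "finite I" by (simp add: I_def)
  have "card I = 4 * (2 * k + 1)" by (simp add: I_def card_cartesian_product)
  then have I: "card I \<le> 12 * k" using k by simp
  have "card {w \<in> oct_V n. linf_dist u w = int k} \<le> card (F1 ` I \<union> F2 ` I \<union> F3 ` I)"
    using fin by (intro card_mono sub) auto
  also have "\<dots> \<le> card (F1 ` I) + card (F2 ` I) + card (F3 ` I)"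
    by (meson add_le_mono card_Un_le le_refl order_trans)
  also have "\<dots> \<le> card I + card I + card I"
    using fin by (intro add_mono card_image_le)
  finally show ?thesis using I by simp
qed

lemma harm_le: "k \<ge> 1 \<Longrightarrow> (\<Sum>i=1..k. 1 / real i) \<le> 1 + ln (real k)"
proof (induction k rule: nat_induct_at_least)
  case (Suc k)
  have "ln (real k / real (Suc k)) \<le> real k / real (Suc k) - 1"
    using Suc.hyps by (intro ln_le_minus_one) auto
  also have "\<dots> = - (1 / real (Suc k))" by (simp add: field_simps)
  finally have "1 / real (Suc k) \<le> ln (real (Suc k)) - ln (real k)"
    using Suc.hyps by (simp add: ln_div)
  then show ?case using Suc.IH by simp
qed simp

lemma ln_ge_half: "n \<ge> 2 \<Longrightarrow> ln (real n) \<ge> 1 / 2"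
proof -
  assume n: "n \<ge> 2"
  have "ln (1 / real n) \<le> 1 / real n - 1" using n by (intro ln_le_minus_one) auto
  moreover have "1 / real n \<le> 1 / 2" using n by simp
  moreover have "ln (1 / real n) = - ln (real n)" using n by (simp add: ln_div)
  ultimately show ?thesis by linarith
qed

text \<open>Shells of the maximum metric have \<open>O(k)\<close> vertices, each of weight at most
  \<open>1 / k^2\<close>, so the normalising sum is harmonic.\<close>

lemma oct_Z_ge:
  assumes n: "n \<ge> 2" and u: "u \<in> oct_V n"
  shows "oct_Z n u \<ge> 1 / (144 * ln (real n))"
proof -
  let ?V = "oct_V n - {u}"
  have range: "nat (linf_dist u w) \<in> {1..2 * n}" if "w \<in> ?V" for w
  proof -
    have "linf_dist u w > 0" using that linf_dist_pos[of u w] by auto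
    moreover have "linf_dist u w \<le> 2 * int n"
    proof -
      have b: "\<bar>fst v\<bar> \<le> int n" "\<bar>fst (snd v)\<bar> \<le> int n" "\<bar>snd (snd v)\<bar> \<le> int n"
        if "v \<in> oct_V n" for v
        using that by (auto simp: oct_V_def)
      have d: "\<bar>x - y\<bar> \<le> 2 * int n" if "\<bar>x\<bar> \<le> int n" "\<bar>y\<bar> \<le> int n" for x y
        using that by linarith
      show ?thesis
        unfolding linf_dist_def using b[OF u] b[of w] that by (intro max.boundedI d) auto
    qed
    ultimately show ?thesis by auto
  qed
  have "(\<Sum>w\<in>?V. 1 / (real (oct_dist n u w))\<^sup>2) \<le> (\<Sum>w\<in>?V. 1 / (real (nat (linf_dist u w)))\<^sup>2)"
  proof (intro sum_mono divide_left_mono power_mono mult_pos_pos)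
    fix w assume w: "w \<in> ?V"
    have "linf_dist u w \<le> int (oct_dist n u w)" "linf_dist u w > 0"
      using w u linf_dist_le_oct_dist[of u n w] linf_dist_pos[of u w] by auto
    then show "real (nat (linf_dist u w)) \<le> real (oct_dist n u w)"
      "(real (nat (linf_dist u w)))\<^sup>2 > 0" "(real (oct_dist n u w))\<^sup>2 > 0" by auto
  qed auto
  also have "\<dots> = (\<Sum>k=1..2 * n. \<Sum>w\<in>{w \<in> ?V. nat (linf_dist u w) = k}. 1 / (real (nat (linf_dist u w)))\<^sup>2)"
    by (rule sum.group[symmetric]) (use range finite_oct_V in blast)+
  also have "\<dots> \<le> (\<Sum>k=1..2 * n. 36 * (1 / real k))"
  proof (intro sum_mono)
    fix k assume k: "k \<in> {1..2 * n}"
    let ?S = "{w \<in> ?V. nat (linf_dist u w) = k}"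
    have "?S \<subseteq> {w \<in> oct_V n. linf_dist u w = int k}" using k by auto
    then have "card ?S \<le> card {w \<in> oct_V n. linf_dist u w = int k}"
      by (intro card_mono) (auto simp: finite_oct_V)
    also have "\<dots> \<le> 36 * k" using k by (intro sphere_card_le u) auto
    finally have card: "real (card ?S) \<le> 36 * real k" by linarith
    have "(\<Sum>w\<in>?S. 1 / (real (nat (linf_dist u w)))\<^sup>2) = real (card ?S) * (1 / (real k)\<^sup>2)"
      by simp
    also have "\<dots> \<le> 36 * real k * (1 / (real k)\<^sup>2)"
      by (intro mult_right_mono card) simp
    also have "\<dots> = 36 * (1 / real k)" using k by (simp add: power2_eq_square)
    finally show "(\<Sum>w\<in>?S. 1 / (real (nat (linf_dist u w)))\<^sup>2) \<le> 36 * (1 / real k)" .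
  qed
  also have "\<dots> = 36 * (\<Sum>k=1..2 * n. 1 / real k)" by (simp add: sum_distrib_left)
  also have "\<dots> \<le> 36 * (1 + ln (real (2 * n)))" using n harm_le[of "2 * n"] by simp
  also have "ln (real (2 * n)) = ln 2 + ln (real n)" using n by (simp add: ln_mult)
  \<comment> \<open>\<open>1 \<le> 2 * ln n\<close> and \<open>ln 2 \<le> ln n\<close> absorb the
    constants, giving 36 * 4 = 144.\<close>
  also have "36 * (1 + (ln 2 + ln (real n))) \<le> 144 * ln (real n)"
  proof -
    have "ln 2 \<le> ln (real n)" using n by simp
    then show ?thesis using ln_ge_half[OF n] by argo
  qed
  finally have "(\<Sum>w\<in>?V. 1 / (real (oct_dist n u w))\<^sup>2) \<le> 144 * ln (real n)" .
  then show ?thesis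
    using inverse_oct_Z_pos[of n u] n u unfolding oct_Z_def
    by (simp add: inverse_eq_divide frac_le)
qed

text \<open>The numerical constant is \<open>144 * 144 * 43740\<close>: one factor from \<open>oct_Z_ge\<close>, one from
  \<open>card B \<ge> n\<^sup>2 (1 - cosang u t) / 144\<close>, and
  \<open>(oct_dist n u v)\<^sup>2 \<le> 27\<^sup>2 * 60 * n\<^sup>2 (1 - cosang u t)\<close> for \<open>v\<close> in \<open>B\<close>.\<close>

lemma quarter_choice_prob:
  assumes n: "n \<ge> 2" and u: "u \<in> oct_V n" and t: "t \<in> oct_V n" and ut: "u \<noteq> t"
  defines "B \<equiv> {v \<in> oct_V n - {u}. 1 - cosang v t \<le> (1 - cosang u t) / 4}"
  shows "(\<Sum>v\<in>B. lr_prob n u v) \<ge> 1 / (906992640 * ln (real n))"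
    and "(real n)\<^sup>2 * (1 - cosang u t) \<ge> 1 / 24"
proof -
  define Q where "Q = (real n)\<^sup>2 * (1 - cosang u t)"
  have n1: "n \<ge> 1" using n by simp
  have "1 \<le> l1_dist u t"
    using ut by (auto simp: l1_dist_def prod_eq_iff)
  then have "1 \<le> (real_of_int (l1_dist u t))\<^sup>2" by simp
  also have "\<dots> \<le> 24 * Q"
    using l1_dist_le_chord[OF n1 u t] by (simp add: Q_def)
  finally have Q: "Q \<ge> 1 / 24" by simp
  then show "(real n)\<^sup>2 * (1 - cosang u t) \<ge> 1 / 24" by (simp add: Q_def)
  have q: "1 - cosang u t > 0"
  proof (rule ccontr)
    assume "\<not> 1 - cosang u t > 0"
    then have "Q \<le> 0" unfolding Q_def by (intro mult_nonneg_nonpos) auto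
    with Q show False by simp
  qed
  have "1 - cosang u t \<le> 2"
    using cosang_ge_minus_1[OF n1 u t] by simp
  then have Q2: "Q \<le> 2 * (real n)\<^sup>2"
    unfolding Q_def by (subst mult.commute) (intro mult_right_mono, auto)
  \<comment> \<open>The radius makes \<open>36 * m^2 \<le> Q / 4\<close>, which is the quartering,
    while \<open>(m + 1)^2\<close> is still at least \<open>Q / 144\<close>. For
    \<open>m = 0\<close> the disc is just the target.\<close>
  define m where "m = nat \<lfloor>sqrt Q / 12\<rfloor>"
  have m: "real m \<le> sqrt Q / 12" "sqrt Q / 12 < real m + 1"
  proof -
    have "real m = real_of_int \<lfloor>sqrt Q / 12\<rfloor>" using Q by (simp add: m_def)
    then show "real m \<le> sqrt Q / 12" "sqrt Q / 12 < real m + 1" by linarith+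
  qed
  have "sqrt Q \<le> 2 * real n"
  proof (rule real_le_lsqrt)
    have "(2 * real n)\<^sup>2 = 4 * (real n)\<^sup>2" by (simp add: power_mult_distrib)
    then show "Q \<le> (2 * real n)\<^sup>2" using Q2 zero_le_power2[of "real n"] by linarith
  qed simp
  then have "real (6 * m) \<le> real n" using m(1) by simp
  then have "6 * m \<le> n" by linarith
  from lattice_disc[OF t this] obtain A where A: "A \<subseteq> oct_V n" "card A = (m + 1)\<^sup>2"
    "\<forall>v\<in>A. (norm (vec v - vec t))\<^sup>2 \<le> 6 * (real m)\<^sup>2"
    by (elim exE conjE)
  have mQ: "(real m)\<^sup>2 \<le> Q / 144"
  proof -
    have "(real m)\<^sup>2 \<le> (sqrt Q / 12)\<^sup>2" using m(1) by (intro power_mono) auto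
    then show ?thesis using Q by (simp add: power_divide)
  qed
  have AB: "A \<subseteq> B"
  proof
    fix v assume v: "v \<in> A"
    then have vV: "v \<in> oct_V n" using A by auto
    have "(real n)\<^sup>2 * (1 - cosang v t) \<le> 6 * (6 * (Q / 144))"
      using one_minus_cosang_le[OF n1 vV t] A(3)[rule_format, OF v] mQ by linarith
    also have "\<dots> = (real n)\<^sup>2 * ((1 - cosang u t) / 4)" by (simp add: Q_def)
    finally have le: "1 - cosang v t \<le> (1 - cosang u t) / 4"
      using n by (simp add: mult_le_cancel_left_pos)
    then have "v \<noteq> u" using q by auto
    with le vV show "v \<in> B" by (simp add: B_def)
  qed
  have fB: "finite B" by (simp add: B_def finite_oct_V)
  have "Q / 144 \<le> (real m + 1)\<^sup>2"
  proof -
    have "(sqrt Q / 12)\<^sup>2 \<le> (real m + 1)\<^sup>2" using m(2) Q by (intro power_mono) auto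
    then show ?thesis using Q by (simp add: power_divide)
  qed
  also have "\<dots> = real (card A)" by (simp add: A)
  also have "\<dots> \<le> real (card B)" using card_mono[OF fB AB] by simp
  finally have cardB: "Q / 144 \<le> real (card B)" .
  have ln: "ln (real n) > 0" using ln_ge_half[OF n] by simp
  have each: "1 / (144 * ln (real n)) / (43740 * Q) \<le> lr_prob n u v" if v: "v \<in> B" for v
  proof -
    have vV: "v \<in> oct_V n" "v \<noteq> u" using v by (auto simp: B_def)
    have d0: "oct_dist n u v > 0" using oct_dist_pos[OF u vV(1)] vV(2) by simp
    \<comment> \<open>2 + 2 / 4 = 5 / 2 from the triangle inequality; times 24 this yields
      60.\<close>
    have "(real n)\<^sup>2 * (1 - cosang u v) \<le> (real n)\<^sup>2 * (5 / 2 * (1 - cosang u t))"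
      using one_minus_cosang_triangle[OF n1 u vV(1) t] v by (intro mult_left_mono) (auto simp: B_def)
    then have l1: "(real_of_int (l1_dist u v))\<^sup>2 \<le> 60 * Q"
      using l1_dist_le_chord[OF n1 u vV(1)] by (simp add: Q_def algebra_simps)
    have "real (oct_dist n u v) \<le> 27 * real_of_int (l1_dist u v)"
      using oct_dist_le_l1_dist[OF u vV(1)] by linarith
    then have "(real (oct_dist n u v))\<^sup>2 \<le> (27 * real_of_int (l1_dist u v))\<^sup>2"
      by (intro power_mono) auto
    also have "\<dots> \<le> 43740 * Q" using l1 by (simp add: power_mult_distrib)
    finally have "(real (oct_dist n u v))\<^sup>2 \<le> 43740 * Q" .
    then show ?thesis
      unfolding lr_prob_def using oct_Z_ge[OF n u] d0 ln Q oct_Z_pos[OF n1 u]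
      by (intro frac_le) auto
  qed
  \<comment> \<open>\<open>Q\<close> cancels: the disc has order \<open>Q\<close> vertices, each
    chosen with weight of order \<open>1 / Q\<close>. So the inverse-square law treats all scales
    alike.\<close>
  have "1 / (906992640 * ln (real n)) = Q / 144 * (1 / (144 * ln (real n)) / (43740 * Q))"
    using Q ln by (simp add: field_simps)
  also have "\<dots> \<le> real (card B) * (1 / (144 * ln (real n)) / (43740 * Q))"
    using cardB Q ln by (intro mult_right_mono) auto
  also have "\<dots> \<le> (\<Sum>v\<in>B. lr_prob n u v)"
    using each by (intro sum_bounded_below)
  finally show "(\<Sum>v\<in>B. lr_prob n u v) \<ge> 1 / (906992640 * ln (real n))" .
qed

section \<open>The logarithmic potential and the final bound\<close>

lemma ln_one_plus_quarter_drop: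
  fixes a b :: real
  assumes "a \<ge> 1 / 24" "b \<ge> 0" "b \<le> a / 4"
  shows "ln (1 + b) \<le> ln (1 + a) - ln (100 / 97)"
proof -
  \<comment> \<open>The extreme case is \<open>a = 1 / 24\<close>, \<open>b = 1 / 96\<close>, where
    the ratio is (25 / 24) / (97 / 96) = 100 / 97.\<close>
  have "100 / 97 * (1 + b) \<le> 1 + a" using assms by simp
  then have "ln (100 / 97 * (1 + b)) \<le> ln (1 + a)"
    using assms by (subst ln_le_cancel_iff) auto
  then show ?thesis using assms by (subst (asm) ln_mult) auto
qed

theorem theorem2:
  shows "\<exists>c::real. c > 0 \<and>
    (\<forall>n::nat. n \<ge> 2 \<longrightarrow> (\<forall>s\<in>oct_V n. \<forall>t\<in>oct_V n. \<forall>tb. valid_tiebreak tb \<longrightarrow>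
       expected_forwards n tb s t \<le> ennreal (c * (ln (real n))^2)))"
proof -
  define \<delta> where "\<delta> = ln (100 / 97 :: real)"
  have \<delta>: "\<delta> > 0" by (simp add: \<delta>_def)
  \<comment> \<open>Chosen so that the success probability times the drop
    \<open>K * ln n * \<delta>\<close> is exactly 1, the cost of one forward.\<close>
  define K where "K = 906992640 / \<delta>"
  have K: "K > 0" using \<delta> by (simp add: K_def)
  have main: "expected_forwards n tb s t \<le> ennreal (4 * K * (ln (real n))\<^sup>2)"
    if n: "n \<ge> 2" and s: "s \<in> oct_V n" and t: "t \<in> oct_V n" and tb: "valid_tiebreak tb" for n s t tb
  proof -
    have n1: "n \<ge> 1" using n by simp
    interpret R: greedy_routing n t tb
      using n1 t tb exists_closer_neighbour[OF _ t] by unfold_locales blast+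
    define Q where "Q v = (real n)\<^sup>2 * (1 - cosang v t)" for v
    define H where "H v = K * ln (real n) * ln (1 + Q v)" for v
    have Q_nonneg: "Q v \<ge> 0" if "v \<in> oct_V n" for v
      using cosang_le_1[OF n1 that t] by (simp add: Q_def)
    have ln_pos: "ln (real n) > 0" using ln_ge_half[OF n] by simp
    have H_target: "H t \<ge> 0" using Q_nonneg[OF t] K ln_pos by (simp add: H_def)
    have H_mono: "H v \<le> H w" if "v \<in> oct_V n" "w \<in> oct_V n" "cosang w t \<le> cosang v t" for v w
    proof -
      have "Q v \<le> Q w" unfolding Q_def using that by (intro mult_left_mono) auto
      then show ?thesis
        unfolding H_def using Q_nonneg[OF that(1)] K ln_pos by (intro mult_left_mono) auto
    qed
    have H_step: "1 + (\<Sum>x\<in>oct_V n - {u}. lr_prob n u x * H (greedy_step n (\<lambda>_. x) tb t u)) \<le> H u"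
      if u: "u \<in> oct_V n" "u \<noteq> t" for u
    proof -
      define B where "B = {v \<in> oct_V n - {u}. 1 - cosang v t \<le> (1 - cosang u t) / 4}"
      let ?g = "\<lambda>x. greedy_step n (\<lambda>_. x) tb t u"
      let ?D = "K * ln (real n) * \<delta>"
      note B = quarter_choice_prob[OF n u(1) t u(2), folded B_def]
      have each: "H (?g x) \<le> H u - (if x \<in> B then ?D else 0)" if x: "x \<in> oct_V n - {u}" for x
      proof -
        have g: "?g x \<in> oct_V n" "cosang u t < cosang (?g x) t" "cosang x t \<le> cosang (?g x) t"
          using R.greedy_step_in[of "\<lambda>_. x" u] R.greedy_step_increases[of "\<lambda>_. x" u]
            R.greedy_step_ge_choice[of "\<lambda>_. x" u] x u by auto
        show ?thesis
        proof (cases "x \<in> B")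
          case True
          then have xV: "x \<in> oct_V n" and "1 - cosang x t \<le> (1 - cosang u t) / 4"
            by (auto simp: B_def)
          then have "(real n)\<^sup>2 * (1 - cosang x t) \<le> (real n)\<^sup>2 * ((1 - cosang u t) / 4)"
            by (intro mult_left_mono) auto
          then have "ln (1 + Q x) \<le> ln (1 + Q u) - \<delta>"
            using B(2) Q_nonneg[OF xV] unfolding \<delta>_def Q_def
            by (intro ln_one_plus_quarter_drop) auto
          then have "K * ln (real n) * ln (1 + Q x) \<le> K * ln (real n) * (ln (1 + Q u) - \<delta>)"
            using K ln_pos by (intro mult_left_mono) auto
          then have "H x \<le> H u - ?D" by (simp add: H_def algebra_simps)
          \<comment> \<open>Greedy routing need not use the edge to \<open>x\<close>, but whatever
            it uses is at least as close to \<open>t\<close>.\<close>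
          moreover have "H (?g x) \<le> H x" using g xV by (intro H_mono) auto
          ultimately show ?thesis using True by simp
        next
          case False
          then show ?thesis using H_mono[of "?g x" u] g u by simp
        qed
      qed
      have "(\<Sum>x\<in>oct_V n - {u}. lr_prob n u x * H (?g x))
          \<le> (\<Sum>x\<in>oct_V n - {u}. lr_prob n u x * (H u - (if x \<in> B then ?D else 0)))"
        using each lr_prob_nonneg[OF n1 u(1)] by (intro sum_mono mult_left_mono)
      also have "\<dots> = (\<Sum>x\<in>oct_V n - {u}. lr_prob n u x * H u - (if x \<in> B then lr_prob n u x * ?D else 0))"
        by (intro sum.cong refl) (simp add: algebra_simps)
      also have "\<dots> = (\<Sum>x\<in>oct_V n - {u}. lr_prob n u x) * H u - (\<Sum>x\<in>B. lr_prob n u x) * ?D"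
      proof -
        have "(oct_V n - {u}) \<inter> B = B" by (auto simp: B_def)
        then show ?thesis
          by (simp add: sum_subtractf sum_distrib_right finite_oct_V flip: sum.inter_restrict)
      qed
      also have "\<dots> \<le> H u - 1 / (906992640 * ln (real n)) * ?D"
        using B(1) K ln_pos \<delta> sum_lr_prob[OF n1 u(1)] mult_right_mono[OF B(1), of ?D] by simp
      also have "1 / (906992640 * ln (real n)) * ?D = 1"
        using ln_pos \<delta> by (simp add: K_def)
      finally show ?thesis by simp
    qed
    have "expected_forwards n tb s t \<le> ennreal (H s)"
      using H_target H_step s by (rule R.expected_forwards_le)
    also have "H s \<le> 4 * K * (ln (real n))\<^sup>2"
    proof -
      have "Q s \<le> (real n)\<^sup>2 * 2"
        unfolding Q_def using cosang_ge_minus_1[OF n1 s t] by (intro mult_left_mono) auto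
      \<comment> \<open>The origin of the factor 4: \<open>1 + Q s\<close> is at most
        \<open>n^4\<close> once \<open>n \<ge> 2\<close>.\<close>
      moreover have "1 + 2 * (real n)\<^sup>2 \<le> real n ^ 4"
      proof -
        have "(real n)\<^sup>2 \<ge> 2\<^sup>2" using n by (intro power_mono) auto
        then have "(real n)\<^sup>2 * ((real n)\<^sup>2 - 2) \<ge> 4 * 2" by (intro mult_mono) auto
        then show ?thesis by (simp add: algebra_simps power2_eq_square power4_eq_xxxx)
      qed
      ultimately have "1 + Q s \<le> real n ^ 4" by simp
      then have "ln (1 + Q s) \<le> ln (real n ^ 4)"
        using Q_nonneg[OF s] n by (subst ln_le_cancel_iff) auto
      also have "\<dots> = 4 * ln (real n)" using n by (simp add: ln_realpow)
      finally have "K * ln (real n) * ln (1 + Q s) \<le> K * ln (real n) * (4 * ln (real n))"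
        using K ln_pos by (intro mult_left_mono) auto
      then show ?thesis by (simp add: H_def power2_eq_square mult_ac)
    qed
    finally show ?thesis by (simp add: ennreal_leI)
  qed
  show ?thesis
    using main K by (intro exI[of _ "4 * K"]) auto
qed

end
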